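(* Let $1\leq p<\infty$ and let $\psi$ be an entire function on $\mathbb{C}$ such that the composition operator $C_\psi f=f\circ\psi$ is bounded on the Fock space $\mathcal{F}_p$. Then the following are equivalent: (1) $C_\psi$ satisfies the Ritt's resolvent condition on $\mathcal{F}_p$; (2) $C_\psi$ is compact on $\mathcal{F}_p$ or $C_\psi$ is the identity map on $\mathcal{F}_p$; (3) $C_\psi$ satisfies the unconditional Ritt's condition on $\mathcal{F}_p$.
   Context: For $1\le p<\infty$, the Fock space $\mathcal{F}_p$ is the Banach space of all entire functions $f:\mathbb{C}\to\mathbb{C}$ with $$\|f\|_p^p=\frac{p}{2\pi}\int_{\mathbb{C}}|f(z)|^p e^{-\frac{p|z|^2}{2}}\,dA(z)<\infty,$$ where $dA$ is Lebesgue area measure on $\mathbb{C}$. A bounded linear operator $T$ on a complex Banach space satisfies the Ritt's resolvent (growth) condition if every $\lambda\in\mathbb{C}$ with $|\lambda|>1$ lies in the resolvent set of $T$ and there is a constant $M>0$ such that $$\|(\lambda I-T)^{-1}\|\leq\frac{M}{|\lambda-1|}\quad\text{for all }\lambda\in\mathbb{C}\text{ with }|\lambda|>1.$$ A bounded linear operator $T$ on a Banach space satisfies the unconditional Ritt's condition if there is a constant $K\ge 0$ such that $$\Big\|\sum_{n\geq 1}a_n\,(T^n-T^{n-1})\Big\|\leq K\sup_n|a_n|$$ for every finite sequence $(a_n)_{n\ge 1}$ of complex numbers, where $T^0=I$ is the identity. *)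

theory Defs
  imports "HOL-Complex_Analysis.Complex_Analysis"
begin

text \<open>
  Since the exponent \<open>p\<close> is a parameter, the Fock space is a carrier set of functions with its own
  norm, and the operator-theoretic notions are relative to a carrier \<open>V\<close> of complex-valued
  functions (with pointwise operations) and a norm \<open>N\<close> on it. An operator is a function on all of
  \<open>'a \<Rightarrow> complex\<close> of which only the restriction to \<open>V\<close> matters.
\<close>

definition bounded_op ::
  "('a \<Rightarrow> complex) set \<Rightarrow> (('a \<Rightarrow> complex) \<Rightarrow> real) \<Rightarrow> (('a \<Rightarrow> complex) \<Rightarrow> ('a \<Rightarrow> complex)) \<Rightarrow> bool"
where
  "bounded_op V N T \<longleftrightarrow>
     (\<forall>f\<in>V. T f \<in> V) \<and>
     (\<forall>f\<in>V. \<forall>g\<in>V. T (\<lambda>x. f x + g x) = (\<lambda>x. T f x + T g x)) \<and>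
     (\<forall>c. \<forall>f\<in>V. T (\<lambda>x. c * f x) = (\<lambda>x. c * T f x)) \<and>
     (\<exists>C. \<forall>f\<in>V. N (T f) \<le> C * N f)"

text \<open>The supremum is meaningful only when \<open>T\<close> is bounded.\<close>

definition op_norm ::
  "('a \<Rightarrow> complex) set \<Rightarrow> (('a \<Rightarrow> complex) \<Rightarrow> real) \<Rightarrow> (('a \<Rightarrow> complex) \<Rightarrow> ('a \<Rightarrow> complex)) \<Rightarrow> real"
where
  "op_norm V N T = (SUP f\<in>{f\<in>V. N f \<le> 1}. N (T f))"

definition resolvent_op ::
  "('a \<Rightarrow> complex) set \<Rightarrow> (('a \<Rightarrow> complex) \<Rightarrow> ('a \<Rightarrow> complex)) \<Rightarrow> complex \<Rightarrow>
   ('a \<Rightarrow> complex) \<Rightarrow> ('a \<Rightarrow> complex)"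
where
  "resolvent_op V T l = inv_into V (\<lambda>f x. l * f x - T f x)"

definition resolvent_set ::
  "('a \<Rightarrow> complex) set \<Rightarrow> (('a \<Rightarrow> complex) \<Rightarrow> real) \<Rightarrow> (('a \<Rightarrow> complex) \<Rightarrow> ('a \<Rightarrow> complex)) \<Rightarrow> complex set"
where
  "resolvent_set V N T =
     {l. bij_betw (\<lambda>f x. l * f x - T f x) V V \<and> bounded_op V N (resolvent_op V T l)}"

definition ritt_resolvent_condition ::
  "('a \<Rightarrow> complex) set \<Rightarrow> (('a \<Rightarrow> complex) \<Rightarrow> real) \<Rightarrow> (('a \<Rightarrow> complex) \<Rightarrow> ('a \<Rightarrow> complex)) \<Rightarrow> bool"
where
  "ritt_resolvent_condition V N T \<longleftrightarrow>
     bounded_op V N T \<and>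
     (\<forall>l. cmod l > 1 \<longrightarrow> l \<in> resolvent_set V N T) \<and>
     (\<exists>M>0. \<forall>l. cmod l > 1 \<longrightarrow> op_norm V N (resolvent_op V T l) \<le> M / cmod (l - 1))"

text \<open>
  The finite sequence is \<open>a 1, \<dots>, a m\<close>. The empty one is excluded because the supremum of the
  empty set of reals is unspecified; its inequality would be \<open>0 \<le> 0\<close>.
\<close>

definition unconditional_ritt_condition ::
  "('a \<Rightarrow> complex) set \<Rightarrow> (('a \<Rightarrow> complex) \<Rightarrow> real) \<Rightarrow> (('a \<Rightarrow> complex) \<Rightarrow> ('a \<Rightarrow> complex)) \<Rightarrow> bool"
where
  "unconditional_ritt_condition V N T \<longleftrightarrow>
     bounded_op V N T \<and>
     (\<exists>K\<ge>0. \<forall>(m::nat) (a :: nat \<Rightarrow> complex). m \<ge> 1 \<longrightarrow>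
        op_norm V N (\<lambda>f x. \<Sum>n=1..m. a n * ((T ^^ n) f x - (T ^^ (n - 1)) f x))
          \<le> K * (SUP n\<in>{1..m}. cmod (a n)))"

definition norm_topology ::
  "('a \<Rightarrow> complex) set \<Rightarrow> (('a \<Rightarrow> complex) \<Rightarrow> real) \<Rightarrow> ('a \<Rightarrow> complex) topology"
where
  "norm_topology V N = Metric_space.mtopology V (\<lambda>f g. N (\<lambda>x. f x - g x))"

definition compact_op ::
  "('a \<Rightarrow> complex) set \<Rightarrow> (('a \<Rightarrow> complex) \<Rightarrow> real) \<Rightarrow> (('a \<Rightarrow> complex) \<Rightarrow> ('a \<Rightarrow> complex)) \<Rightarrow> bool"
where
  "compact_op V N T \<longleftrightarrow>
     bounded_op V N T \<and>
     compactin (norm_topology V N) (norm_topology V N closure_of (T ` {f\<in>V. N f \<le> 1}))"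

definition fock_space :: "real \<Rightarrow> (complex \<Rightarrow> complex) set" where
  "fock_space p =
     {f. f holomorphic_on UNIV \<and>
         integrable lborel (\<lambda>z. cmod (f z) powr p * exp (- (p * (cmod z)\<^sup>2 / 2)))}"

definition fock_norm :: "real \<Rightarrow> (complex \<Rightarrow> complex) \<Rightarrow> real" where
  "fock_norm p f =
     (p / (2 * pi) * (LINT z|lborel. cmod (f z) powr p * exp (- (p * (cmod z)\<^sup>2 / 2)))) powr (1 / p)"

definition comp_op :: "(complex \<Rightarrow> complex) \<Rightarrow> (complex \<Rightarrow> complex) \<Rightarrow> (complex \<Rightarrow> complex)" where
  "comp_op \<psi> f = f \<circ> \<psi>"

end

(* Testing the operator on reproducing kernels shows that a bounded composition operator has an
   affine symbol a z + b with |a| <= 1, and b = 0 if |a| = 1.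

   If |a| < 1, the iterates of the symbol converge to its fixed point z0, and the Cauchy estimates
   give |f(psi^n z) - f(z0)| <= A |a|^n |f| exp(q |z|^2 / 2) for n >= 1 with some q < 1. As the
   right-hand side is p-integrable against the Gaussian weight, the norms of T^(n+1) - T^n decay
   geometrically (unconditional Ritt), and the resolvent is the evaluation at z0 divided by
   lambda - 1 plus a remainder of size 1 / |lambda| (Ritt). Compactness follows from Montel's
   theorem and dominated convergence with the same kind of majorant.

   If |a| = 1 and a is not 1, the eigenfunction z with eigenvalue a contradicts both Ritt
   conditions, and the kernels at infinity contradict compactness. *)

theory Submission
  imports Defs "HOL-Probability.Distributions" "HOL-Real_Asymp.Real_Asymp"
begin

section \<open>Lebesgue measure on the complex plane\<close>

text \<open>Point evaluations only give |f(z)| <= C |f| exp(|z|^2/2), which the Gaussian weight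
  cancels exactly, so this bound alone controls no norm. One application of a contractive symbol
  replaces |z|^2 by |a|^2 |z|^2 plus lower-order terms, and the strict gap absorbs the linear terms
  that Cauchy's estimate adds. Hence estimates for iterates start at the first power; the zeroth is
  handled separately, by boundedness of \<open>T\<close> or, in the resolvent, as the explicit term
  (f - f(z0))/lambda. The resolvent is a pointwise convergent series of entire functions whose norm
  is read off from a Gaussian majorant. Point evaluation at 0 is bounded by averaging the mean value
  property over circles, which requires rotation invariance of area measure (hence the shears); Weyl
  translations then carry the bound to other points. The same translations show that the kernel
  exp(conj(w) z) has norm exp(|w|^2/2) up to a constant, although its value at w is exp(|w|^2); this
  half of the exponent is what yields |psi(z)|^2 <= |z|^2 + K.\<close>

lemma lborel_complex_eq_distr:
  "(lborel :: complex measure) = distr (lborel \<Otimes>\<^sub>M lborel) borel (\<lambda>(x, y). Complex x y)"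
proof (rule lborel_eqI)
  have m: "(\<lambda>(x, y). Complex x y) \<in> borel_measurable (lborel \<Otimes>\<^sub>M lborel)"
    unfolding Complex_eq by measurable
  fix l u :: complex assume lu: "\<And>b. b \<in> Basis \<Longrightarrow> l \<bullet> b \<le> u \<bullet> b"
  have le: "Re l \<le> Re u" "Im l \<le> Im u"
    using lu[of 1] lu[of \<i>] by (auto simp: Basis_complex_def inner_complex_def)
  have "emeasure (distr (lborel \<Otimes>\<^sub>M lborel) borel (\<lambda>(x, y). Complex x y)) (box l u) =
        emeasure (lborel \<Otimes>\<^sub>M lborel) ({Re l<..<Re u} \<times> {Im l<..<Im u})"
    by (subst emeasure_distr[OF m])
       (auto simp: box_def Basis_complex_def inner_complex_def space_pair_measure intro!: arg_cong2[where f = emeasure])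
  also have "\<dots> = ennreal (Re u - Re l) * ennreal (Im u - Im l)"
    using le by (simp add: lborel.emeasure_pair_measure_Times)
  also have "\<dots> = ennreal (\<Prod>b\<in>Basis. (u - l) \<bullet> b)"
    using le by (simp add: Basis_complex_def inner_complex_def ennreal_mult)
  finally show "emeasure (distr (lborel \<Otimes>\<^sub>M lborel) borel (\<lambda>(x, y). Complex x y)) (box l u)
      = (\<Prod>b\<in>Basis. (u - l) \<bullet> b)" .
qed simp

lemma nn_integral_lborel_complex:
  fixes f :: "complex \<Rightarrow> ennreal"
  assumes [measurable]: "f \<in> borel_measurable borel"
  shows "(\<integral>\<^sup>+z. f z \<partial>lborel) = (\<integral>\<^sup>+x. \<integral>\<^sup>+y. f (Complex x y) \<partial>lborel \<partial>lborel)"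
proof -
  have m: "(\<lambda>(x, y). Complex x y) \<in> borel_measurable (lborel \<Otimes>\<^sub>M lborel)"
    unfolding Complex_eq by measurable
  have "(\<integral>\<^sup>+z. f z \<partial>lborel) = (\<integral>\<^sup>+w. f (case w of (x, y) \<Rightarrow> Complex x y) \<partial>(lborel \<Otimes>\<^sub>M lborel))"
    by (subst lborel_complex_eq_distr, subst nn_integral_distr[OF m]) simp_all
  also have "\<dots> = (\<integral>\<^sup>+x. \<integral>\<^sup>+y. f (Complex x y) \<partial>lborel \<partial>lborel)"
    using measurable_compose[OF m assms]
    by (subst lborel.nn_integral_fst[symmetric]) (simp_all add: case_prod_unfold)
  finally show ?thesis .
qed

lemma nn_integral_lborel_complex_swap:
  fixes f :: "complex \<Rightarrow> ennreal"
  assumes [measurable]: "f \<in> borel_measurable borel"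
  shows "(\<integral>\<^sup>+z. f z \<partial>lborel) = (\<integral>\<^sup>+y. \<integral>\<^sup>+x. f (Complex x y) \<partial>lborel \<partial>lborel)"
proof -
  have m: "(\<lambda>(x, y). Complex x y) \<in> borel_measurable (lborel \<Otimes>\<^sub>M lborel)"
    unfolding Complex_eq by measurable
  show ?thesis
    unfolding nn_integral_lborel_complex[OF assms]
    using measurable_compose[OF m assms]
    by (subst lborel_pair.Fubini') (simp_all add: case_prod_unfold)
qed

lemma nn_integral_translate:
  fixes f :: "'a::euclidean_space \<Rightarrow> ennreal"
  assumes [measurable]: "f \<in> borel_measurable borel"
  shows "(\<integral>\<^sup>+x. f (c + x) \<partial>lborel) = (\<integral>\<^sup>+x. f x \<partial>lborel)"
  by (subst (2) lborel_distr_plus[of c, symmetric], subst nn_integral_distr) auto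

lemma borel_measurable_Complex [measurable]:
  assumes [measurable]: "f \<in> borel_measurable M" "g \<in> borel_measurable M"
  shows "(\<lambda>x. Complex (f x) (g x)) \<in> borel_measurable M"
  unfolding Complex_eq by measurable

text \<open>On each vertical line the shear is a translation, so Tonelli reduces the claim to
  translation invariance on the real line.\<close>

lemma nn_integral_shear_Im:
  fixes f :: "complex \<Rightarrow> ennreal"
  assumes [measurable]: "f \<in> borel_measurable borel"
  shows "(\<integral>\<^sup>+z. f (Complex (Re z) (c * Re z + Im z)) \<partial>lborel) = (\<integral>\<^sup>+z. f z \<partial>lborel)"
proof -
  have "(\<integral>\<^sup>+y. f (Complex x (c * x + y)) \<partial>lborel) = (\<integral>\<^sup>+y. f (Complex x y) \<partial>lborel)" for x
    by (rule nn_integral_translate[of "\<lambda>y. f (Complex x y)" "c * x"]) measurable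
  then show ?thesis
    by (subst (1 2) nn_integral_lborel_complex) simp_all
qed

lemma nn_integral_shear_Re:
  fixes f :: "complex \<Rightarrow> ennreal"
  assumes [measurable]: "f \<in> borel_measurable borel"
  shows "(\<integral>\<^sup>+z. f (Complex (c * Im z + Re z) (Im z)) \<partial>lborel) = (\<integral>\<^sup>+z. f z \<partial>lborel)"
proof -
  have "(\<integral>\<^sup>+x. f (Complex (c * y + x) y) \<partial>lborel) = (\<integral>\<^sup>+x. f (Complex x y) \<partial>lborel)" for y
    by (rule nn_integral_translate[of "\<lambda>x. f (Complex x y)" "c * y"]) measurable
  then show ?thesis
    by (subst (1 2) nn_integral_lborel_complex_swap) simp_all
qed

text \<open>A rotation by an angle other than \<open>\<pi>\<close> is a product of three shears.\<close>

lemma nn_integral_rotate: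
  fixes f :: "complex \<Rightarrow> ennreal"
  assumes f [measurable]: "f \<in> borel_measurable borel" and \<omega>: "cmod \<omega> = 1"
  shows "(\<integral>\<^sup>+z. f (\<omega> * z) \<partial>lborel) = (\<integral>\<^sup>+z. f z \<partial>lborel)"
proof -
  have main: "(\<integral>\<^sup>+z. g (w * z) \<partial>lborel) = (\<integral>\<^sup>+z. g z \<partial>lborel)"
    if [measurable]: "g \<in> borel_measurable borel" and w: "cmod w = 1" "w \<noteq> -1" for g :: "complex \<Rightarrow> ennreal" and w
  proof -
    define x y where "x = Re w" and "y = Im w"
    have xy: "x\<^sup>2 + y\<^sup>2 = 1" using w(1) by (simp add: x_def y_def cmod_def)
    have "1 + x \<noteq> 0"
    proof
      assume "1 + x = 0"
      hence "x = -1" by simp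
      with xy have "y = 0" by (simp add: power2_eq_square)
      with \<open>x = -1\<close> w(2) show False by (simp add: x_def y_def complex_eq_iff)
    qed
    \<comment> \<open>For \<open>w = cis \<theta>\<close> this is -tan(\<theta>/2), the parameter of
      the two outer shears; it is finite because \<open>w\<close> is not -1.\<close>
    define t where "t = - (y / (1 + x))"
    have t1: "t * y + 1 = x"
    proof -
      have "y * y = (1 + x) * (1 - x)" using xy by (simp add: power2_eq_square algebra_simps)
      then have "t * y = - (1 - x)" using \<open>1 + x \<noteq> 0\<close> unfolding t_def by (simp add: field_simps)
      then show ?thesis by simp
    qed
    have t2: "t + x * t = - y"
      using \<open>1 + x \<noteq> 0\<close> unfolding t_def by (simp add: divide_simps) algebra
    define S where "S = (\<lambda>z. Complex (t * Im z + Re z) (Im z))"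
    define R where "R = (\<lambda>z. Complex (Re z) (y * Re z + Im z))"
    have [measurable]: "S \<in> borel_measurable borel" "R \<in> borel_measurable borel"
      unfolding S_def R_def by measurable
    have "w * z = S (R (S z))" for z
    proof -
      have "Re (S (R (S z))) = (t * y + 1) * Re z + (t + (t * y + 1) * t) * Im z"
        by (simp add: S_def R_def algebra_simps)
      moreover have "Im (S (R (S z))) = y * Re z + (t * y + 1) * Im z"
        by (simp add: S_def R_def algebra_simps)
      ultimately show ?thesis
        unfolding t1 t2 by (simp add: complex_eq_iff x_def y_def)
    qed
    then have "(\<integral>\<^sup>+z. g (w * z) \<partial>lborel) = (\<integral>\<^sup>+z. g (S (R (S z))) \<partial>lborel)" by simp
    also have "\<dots> = (\<integral>\<^sup>+z. g (S (R z)) \<partial>lborel)"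
      using nn_integral_shear_Re[of "\<lambda>z. g (S (R z))" t] by (simp add: S_def)
    also have "\<dots> = (\<integral>\<^sup>+z. g (S z) \<partial>lborel)"
      using nn_integral_shear_Im[of "\<lambda>z. g (S z)" y] by (simp add: R_def)
    also have "\<dots> = (\<integral>\<^sup>+z. g z \<partial>lborel)"
      using nn_integral_shear_Re[of g t] by (simp add: S_def)
    finally show ?thesis .
  qed
  show ?thesis
  proof (cases "\<omega> = -1")
    \<comment> \<open>The half turn is a product of two quarter turns, each covered by
      \<open>main\<close>.\<close>
    case True
    have "(\<integral>\<^sup>+z. f (\<omega> * z) \<partial>lborel) = (\<integral>\<^sup>+z. f (\<i> * (\<i> * z)) \<partial>lborel)"
      by (simp add: True mult.assoc[symmetric])
    also have "\<dots> = (\<integral>\<^sup>+z. f (\<i> * z) \<partial>lborel)"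
      by (rule main[of "\<lambda>z. f (\<i> * z)"]) (auto simp: complex_eq_iff)
    also have "\<dots> = (\<integral>\<^sup>+z. f z \<partial>lborel)"
      by (rule main) (auto simp: complex_eq_iff)
    finally show ?thesis .
  qed (use main[OF f \<omega>] in simp)
qed

lemma integrable_gaussian_complex:
  assumes "c > 0"
  shows "integrable lborel (\<lambda>z::complex. exp (- (c * (cmod z)\<^sup>2)))"
proof (rule integrableI_bounded)
  show "(\<lambda>z::complex. exp (- (c * (cmod z)\<^sup>2))) \<in> borel_measurable lborel" by measurable
  define g where "g = (\<lambda>x::real. exp (- (c * x\<^sup>2)))"
  have "integrable lborel g"
  proof -
    \<comment> \<open>The deviation for which the exponent of \<open>normal_density\<close> becomes
      -c x^2.\<close>
    define \<sigma> where "\<sigma> = 1 / sqrt (2 * c)"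
    have s: "2 * \<sigma>\<^sup>2 = 1 / c" using assms by (simp add: \<sigma>_def power_divide)
    have "integrable lborel (\<lambda>x. sqrt (2 * pi * \<sigma>\<^sup>2) * normal_density 0 \<sigma> x)"
      using assms by (intro integrable_mult_right integrable_normal_density) (simp add: \<sigma>_def)
    moreover have "sqrt (2 * pi * \<sigma>\<^sup>2) * normal_density 0 \<sigma> x = g x" for x
      using assms s by (simp add: normal_density_def g_def) (simp add: \<sigma>_def)
    ultimately show ?thesis by simp
  qed
  then have fin: "(\<integral>\<^sup>+x. ennreal (g x) \<partial>lborel) < \<infinity>"
    by (subst nn_integral_eq_integral) (auto simp: g_def)
  have "(\<integral>\<^sup>+z. ennreal (norm (exp (- (c * (cmod z)\<^sup>2)))) \<partial>lborel)
      = (\<integral>\<^sup>+x. \<integral>\<^sup>+y. ennreal (g x) * ennreal (g y) \<partial>lborel \<partial>lborel)"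
    by (subst nn_integral_lborel_complex)
       (auto intro!: nn_integral_cong simp: g_def cmod_power2 ennreal_mult[symmetric] exp_add[symmetric] algebra_simps)
  also have "\<dots> = (\<integral>\<^sup>+x. ennreal (g x) \<partial>lborel) * (\<integral>\<^sup>+x. ennreal (g x) \<partial>lborel)"
    by (subst nn_integral_cmult, simp add: g_def, subst nn_integral_multc) (simp_all add: g_def)
  also have "\<dots> < \<infinity>" using fin by (simp add: ennreal_mult_less_top)
  finally show "(\<integral>\<^sup>+z. ennreal (norm (exp (- (c * (cmod (z::complex))\<^sup>2)))) \<partial>lborel) < \<infinity>" .
qed

section \<open>Mean values of entire functions over circles\<close>

text \<open>Cauchy's formula on the unit circle for \<open>\<lambda>w. f (z * w)\<close>. Rescaling
  the argument instead of the circle keeps the radius fixed and includes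
  \<open>z = 0\<close>.\<close>

lemma circle_mean_value:
  assumes f: "f holomorphic_on UNIV"
  shows "((\<lambda>t. f (z * cis (2 * pi * t))) has_integral f 0) {0..1}"
proof -
  have "(\<lambda>w. f (z * w)) holomorphic_on UNIV"
    using holomorphic_on_compose_gen[of "\<lambda>w. z * w" UNIV f UNIV] f by (auto simp: o_def intro!: holomorphic_intros)
  then have "((\<lambda>w. f (z * w) / (w - 0)) has_contour_integral (2 * of_real pi * \<i> * f (z * 0))) (circlepath 0 1)"
    by (intro Cauchy_integral_circlepath_simple) (auto intro: holomorphic_on_subset)
  then have "((\<lambda>t. f (z * cis (2 * pi * t)) * (2 * of_real pi * \<i>)) has_integral (f 0 * (2 * of_real pi * \<i>))) {0..1}"
    unfolding has_contour_integral_def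
    by (subst (asm) has_integral_cong[where g = "\<lambda>t. f (z * cis (2 * pi * t)) * (2 * of_real pi * \<i>)"])
       (simp add: vector_derivative_circlepath01, simp_all add: circlepath cis_conv_exp mult_ac)
  from has_integral_mult_left[OF this, of "inverse (2 * of_real pi * \<i>)"] show ?thesis
    by (simp add: field_simps)
qed

text \<open>Stated with an extended nonnegative integral over the whole line, so that it can be
  multiplied by a weight and integrated in \<open>z\<close> by Tonelli with only measurability to
  check.\<close>

lemma mean_value_bound:
  assumes f: "f holomorphic_on UNIV"
  shows "ennreal (cmod (f 0)) \<le> (\<integral>\<^sup>+t. ennreal (indicator {0..1} t * cmod (f (z * cis (2 * pi * t)))) \<partial>lborel)"
proof -
  define h where "h = (\<lambda>t::real. f (z * cis (2 * pi * t)))"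
  have cont: "continuous_on A h" for A
    unfolding h_def
    by (intro continuous_on_compose2[OF holomorphic_on_imp_continuous_on[OF f]] continuous_intros) auto
  have "set_integrable lborel {0..1} h"
    by (rule borel_integrable_atLeastAtMost') (rule cont)
  then have *: "integrable lborel (\<lambda>t. indicator {0..1} t *\<^sub>R h t)"
    and "(LINT t:{0..1}|lborel. h t) = integral {0..1} h"
    by (auto simp: set_integrable_def set_borel_integral_eq_integral)
  moreover have "integral {0..1} h = f 0"
    unfolding h_def using circle_mean_value[OF f] by blast
  ultimately have "f 0 = (LINT t|lborel. indicator {0..1} t *\<^sub>R h t)"
    by (simp add: set_lebesgue_integral_def)
  then have "ennreal (cmod (f 0)) \<le> (\<integral>\<^sup>+t. norm (indicator {0..1} t *\<^sub>R h t) \<partial>lborel)"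
    using integral_norm_bound_ennreal[OF *] by simp
  then show ?thesis by (simp add: h_def)
qed

section \<open>Operators on normed spaces of functions\<close>

text \<open>Homogeneity and nonnegativity are asked of all functions, so they rewrite without
  membership side conditions. The Fock norm complies because the integral of a non-integrable
  function is 0.\<close>

locale function_space_norm =
  fixes V :: "('a \<Rightarrow> complex) set" and N :: "('a \<Rightarrow> complex) \<Rightarrow> real"
  assumes zero_mem: "(\<lambda>x. 0) \<in> V"
    and add_mem: "\<And>f g. f \<in> V \<Longrightarrow> g \<in> V \<Longrightarrow> (\<lambda>x. f x + g x) \<in> V"
    and scale_mem: "\<And>f c. f \<in> V \<Longrightarrow> (\<lambda>x. c * f x) \<in> V"
    and norm_nonneg: "\<And>f. 0 \<le> N f"
    and norm_triangle: "\<And>f g. f \<in> V \<Longrightarrow> g \<in> V \<Longrightarrow> N (\<lambda>x. f x + g x) \<le> N f + N g"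
    and norm_scale: "\<And>f c. N (\<lambda>x. c * f x) = cmod c * N f"
    and norm_eq_0: "\<And>f. f \<in> V \<Longrightarrow> N f = 0 \<Longrightarrow> f = (\<lambda>x. 0)"
begin

lemma norm_zero: "N (\<lambda>x. 0) = 0"
  using norm_scale[of 0 "\<lambda>x. 0"] by simp

lemma diff_mem: "f \<in> V \<Longrightarrow> g \<in> V \<Longrightarrow> (\<lambda>x. f x - g x) \<in> V"
  using add_mem[OF _ scale_mem[of g "-1"], of f] by simp

lemma norm_minus_commute: "N (\<lambda>x. f x - g x) = N (\<lambda>x. g x - f x)"
  using norm_scale[of "-1" "\<lambda>x. f x - g x"] by simp

lemma norm_diff_triangle: "f \<in> V \<Longrightarrow> g \<in> V \<Longrightarrow> N (\<lambda>x. f x - g x) \<le> N f + N g"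
  using norm_triangle[OF _ scale_mem[of g "-1"], of f] norm_scale[of "-1" g] by simp

lemma sum_mem: "(\<And>i. i \<in> A \<Longrightarrow> f i \<in> V) \<Longrightarrow> (\<lambda>x. \<Sum>i\<in>A. f i x) \<in> V"
  by (induction A rule: infinite_finite_induct) (auto intro: zero_mem add_mem)

lemma norm_sum: "(\<And>i. i \<in> A \<Longrightarrow> f i \<in> V) \<Longrightarrow> N (\<lambda>x. \<Sum>i\<in>A. f i x) \<le> (\<Sum>i\<in>A. N (f i))"
proof (induction A rule: infinite_finite_induct)
  case (insert i A)
  have "N (\<lambda>x. f i x + (\<Sum>i\<in>A. f i x)) \<le> N (f i) + N (\<lambda>x. \<Sum>i\<in>A. f i x)"
    using insert.prems by (intro norm_triangle sum_mem) auto
  with insert show ?case by force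
qed (simp_all add: norm_zero)

sublocale metric: Metric_space V "\<lambda>f g. N (\<lambda>x. f x - g x)"
proof
  fix f g h
  show "N (\<lambda>x. f x - g x) = 0 \<longleftrightarrow> f = g" if "f \<in> V" "g \<in> V"
    using norm_eq_0[OF diff_mem[OF that]] by (auto simp: norm_zero fun_eq_iff)
  show "N (\<lambda>x. f x - h x) \<le> N (\<lambda>x. f x - g x) + N (\<lambda>x. g x - h x)" if "f \<in> V" "g \<in> V" "h \<in> V"
    using norm_triangle[OF diff_mem[of f g] diff_mem[of g h]] that by simp
  show "0 \<le> N (\<lambda>x. f x - g x)"
    by (rule norm_nonneg)
  show "N (\<lambda>x. f x - g x) = N (\<lambda>x. g x - f x)"
    by (rule norm_minus_commute)
qed

lemma norm_le_of_unit_ball: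
  assumes C: "\<And>f. f \<in> V \<Longrightarrow> N f \<le> 1 \<Longrightarrow> N (T f) \<le> C"
    and hom: "\<And>c f. f \<in> V \<Longrightarrow> T (\<lambda>x. c * f x) = (\<lambda>x. c * T f x)"
    and f: "f \<in> V"
  shows "N (T f) \<le> C * N f"
proof (cases "N f = 0")
  case True
  then have "f = (\<lambda>x. 0)" using norm_eq_0[OF f] by simp
  then have "T f = (\<lambda>x. 0)" using hom[OF zero_mem, of 0] by simp
  then show ?thesis by (simp add: norm_zero True)
next
  case False
  then have pos: "N f > 0" using norm_nonneg[of f] by simp
  let ?c = "complex_of_real (1 / N f)"
  have "N (T (\<lambda>x. ?c * f x)) \<le> C"
    using pos by (intro C scale_mem f, unfold norm_scale) (simp add: norm_divide)
  also have "N (T (\<lambda>x. ?c * f x)) = N (T f) / N f"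
    unfolding hom[OF f] norm_scale using pos by (simp add: norm_divide)
  finally show ?thesis using pos by (simp add: field_simps)
qed

section \<open>Operator norms and the algebra of bounded operators\<close>

lemma op_norm_le:
  assumes "0 \<le> C" "\<And>f. f \<in> V \<Longrightarrow> N (T f) \<le> C * N f"
  shows "op_norm V N T \<le> C"
  unfolding op_norm_def
proof (rule cSUP_least)
  show "{f \<in> V. N f \<le> 1} \<noteq> {}" using zero_mem norm_zero by auto
  fix f assume "f \<in> {f \<in> V. N f \<le> 1}"
  then have "N (T f) \<le> C * N f" "C * N f \<le> C * 1"
    using assms by (auto intro: mult_left_le)
  then show "N (T f) \<le> C" by simp
qed

lemma norm_le_op_norm:
  assumes T: "bounded_op V N T" and f: "f \<in> V"
  shows "N (T f) \<le> op_norm V N T * N f"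
proof (rule norm_le_of_unit_ball[OF _ _ f])
  obtain C where C: "\<And>f. f \<in> V \<Longrightarrow> N (T f) \<le> C * N f"
    using T unfolding bounded_op_def by blast
  \<comment> \<open>A supremum of reals is informative only for a set bounded above. The absolute
    value enters because \<open>C\<close> carries no sign.\<close>
  have "bdd_above ((\<lambda>f. N (T f)) ` {f \<in> V. N f \<le> 1})"
  proof (rule bdd_aboveI2)
    fix g assume g: "g \<in> {f \<in> V. N f \<le> 1}"
    have "C * N g \<le> \<bar>C\<bar> * 1"
      using g norm_nonneg[of g] by (intro mult_mono) auto
    then show "N (T g) \<le> \<bar>C\<bar>" using C[of g] g by simp
  qed
  then show "N (T g) \<le> op_norm V N T" if "g \<in> V" "N g \<le> 1" for g
    unfolding op_norm_def using that by (intro cSUP_upper) auto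
qed (use T in \<open>simp add: bounded_op_def\<close>)

lemma bounded_op_nonneg_bound:
  assumes "bounded_op V N T"
  obtains C where "0 \<le> C" "\<And>f. f \<in> V \<Longrightarrow> N (T f) \<le> C * N f"
proof -
  obtain C where C: "\<And>f. f \<in> V \<Longrightarrow> N (T f) \<le> C * N f"
    using assms unfolding bounded_op_def by blast
  have "N (T f) \<le> \<bar>C\<bar> * N f" if "f \<in> V" for f
    using C[OF that] mult_right_mono[OF abs_ge_self[of C] norm_nonneg[of f]] by simp
  then show ?thesis by (intro that[of "\<bar>C\<bar>"]) auto
qed

lemma bounded_op_compose:
  assumes S: "bounded_op V N S" and T: "bounded_op V N T"
  shows "bounded_op V N (\<lambda>f. S (T f))"
proof -
  obtain C where C: "0 \<le> C" "\<And>f. f \<in> V \<Longrightarrow> N (S f) \<le> C * N f"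
    using bounded_op_nonneg_bound[OF S] by blast
  obtain D where D: "0 \<le> D" "\<And>f. f \<in> V \<Longrightarrow> N (T f) \<le> D * N f"
    using bounded_op_nonneg_bound[OF T] by blast
  have "N (S (T f)) \<le> (C * D) * N f" if "f \<in> V" for f
  proof -
    have "N (S (T f)) \<le> C * N (T f)" using C(2) T that by (auto simp: bounded_op_def)
    also have "\<dots> \<le> C * (D * N f)" using C(1) D(2)[OF that] by (intro mult_left_mono)
    finally show ?thesis by (simp add: mult.assoc)
  qed
  then show ?thesis using S T unfolding bounded_op_def by auto
qed

lemma bounded_op_funpow:
  assumes "bounded_op V N T"
  shows "bounded_op V N (T ^^ n)"
proof (induction n)
  case 0
  show ?case by (auto simp: bounded_op_def intro!: exI[of _ 1])
next
  case (Suc n)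
  then show ?case using bounded_op_compose[OF assms] by (simp add: o_def)
qed

lemma bounded_op_scale:
  assumes T: "bounded_op V N T"
  shows "bounded_op V N (\<lambda>f x. c * T f x)"
proof -
  obtain C where C: "0 \<le> C" "\<And>f. f \<in> V \<Longrightarrow> N (T f) \<le> C * N f"
    using bounded_op_nonneg_bound[OF T] by blast
  have "N (\<lambda>x. c * T f x) \<le> (cmod c * C) * N f" if "f \<in> V" for f
    using mult_left_mono[OF C(2)[OF that], of "cmod c"] by (simp add: norm_scale mult.assoc)
  then show ?thesis
    using T scale_mem unfolding bounded_op_def
    by (intro conjI exI[of _ "cmod c * C"]) (auto simp: distrib_left mult_ac)
qed

lemma bounded_op_add:
  assumes S: "bounded_op V N S" and T: "bounded_op V N T"
  shows "bounded_op V N (\<lambda>f x. S f x + T f x)"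
proof -
  obtain C where C: "0 \<le> C" "\<And>f. f \<in> V \<Longrightarrow> N (S f) \<le> C * N f"
    using bounded_op_nonneg_bound[OF S] by blast
  obtain D where D: "0 \<le> D" "\<And>f. f \<in> V \<Longrightarrow> N (T f) \<le> D * N f"
    using bounded_op_nonneg_bound[OF T] by blast
  have "N (\<lambda>x. S f x + T f x) \<le> (C + D) * N f" if "f \<in> V" for f
    using norm_triangle[of "S f" "T f"] C(2)[OF that] D(2)[OF that] S T that
    by (auto simp: bounded_op_def algebra_simps)
  then show ?thesis
    using S T add_mem unfolding bounded_op_def
    by (intro conjI exI[of _ "C + D"]) (auto simp: distrib_left add_ac)
qed

lemma bounded_op_diff:
  "bounded_op V N S \<Longrightarrow> bounded_op V N T \<Longrightarrow> bounded_op V N (\<lambda>f x. S f x - T f x)"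
  using bounded_op_add[of S "\<lambda>f x. -1 * T f x"] bounded_op_scale[of T "-1"] by simp

lemma bounded_op_zero: "bounded_op V N (\<lambda>f x. 0)"
  by (auto simp: bounded_op_def zero_mem norm_zero intro!: exI[of _ 0])

lemma bounded_op_sum:
  "(\<And>i. i \<in> A \<Longrightarrow> bounded_op V N (T i)) \<Longrightarrow> bounded_op V N (\<lambda>f x. \<Sum>i\<in>A. T i f x)"
  by (induction A rule: infinite_finite_induct) (auto intro: bounded_op_add bounded_op_zero)

lemma funpow_eigenvector:
  assumes T: "bounded_op V N T" and e: "e \<in> V" "T e = (\<lambda>x. a * e x)"
  shows "(T ^^ n) e = (\<lambda>x. a ^ n * e x)"
proof (induction n)
  case (Suc n)
  have "T (\<lambda>x. a ^ n * e x) = (\<lambda>x. a ^ n * T e x)"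
    using T e(1) by (simp add: bounded_op_def)
  with Suc e(2) show ?case by (simp add: mult_ac)
qed simp

section \<open>Unimodular eigenvalues under the Ritt conditions\<close>

text \<open>On an eigenvector the n-th difference acts as a^(n-1) (a - 1), whose modulus does not
  decay. Unimodular coefficients can align these numbers, so the sum grows linearly in
  \<open>m\<close> against a fixed bound \<open>K\<close>.\<close>

lemma unconditional_ritt_eigenvalue:
  assumes R: "unconditional_ritt_condition V N T"
    and e: "e \<in> V" "N e \<noteq> 0" "T e = (\<lambda>x. a * e x)" and a: "cmod a = 1"
  shows "a = 1"
proof (rule ccontr)
  assume "a \<noteq> 1"
  have T: "bounded_op V N T" using R by (simp add: unconditional_ritt_condition_def)
  define D where "D = (\<lambda>(m::nat) (c::nat \<Rightarrow> complex) f x. \<Sum>n=1..m. c n * ((T ^^ n) f x - (T ^^ (n - 1)) f x))"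
  obtain K where K: "K \<ge> 0" "\<And>m c. m \<ge> 1 \<Longrightarrow> op_norm V N (D m c) \<le> K * (SUP n\<in>{1..m}. cmod (c n))"
    using R unfolding unconditional_ritt_condition_def D_def by blast
  have Ne: "N e > 0" using e(2) norm_nonneg[of e] by simp
  \<comment> \<open>These coefficients cancel the rotation: every term of the sum becomes \<open>(1 - cnj a) * e\<close>.\<close>
  define c where "c = (\<lambda>n. cnj (a ^ n))"
  have ac: "a * cnj a = 1" using a by (simp add: complex_norm_square[symmetric])
  have *: "real m * cmod (1 - cnj a) \<le> K" if m: "m \<ge> 1" for m
  proof -
    have "D m c e = (\<lambda>x. (of_nat m * (1 - cnj a)) * e x)"
    proof
      fix x
      have "c n * ((T ^^ n) e x - (T ^^ (n - 1)) e x) = (1 - cnj a) * e x" if n: "n \<in> {1..m}" for n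
      proof -
        obtain k where k: "n = Suc k" using n by (cases n) auto
        have ac': "a ^ k * cnj a ^ k = 1" using ac by (simp flip: power_mult_distrib)
        have "cnj a ^ Suc k * (a ^ Suc k * e x - a ^ k * e x)
            = (a ^ k * cnj a ^ k) * ((a * cnj a) * e x - cnj a * e x)"
          by (simp add: algebra_simps)
        then show ?thesis
          unfolding funpow_eigenvector[OF T e(1,3)] c_def k ac ac' by (simp add: algebra_simps)
      qed
      then show "D m c e x = (of_nat m * (1 - cnj a)) * e x"
        by (simp add: D_def)
    qed
    then have "real m * cmod (1 - cnj a) * N e = N (D m c e)"
      by (simp add: norm_scale norm_mult)
    also have "\<dots> \<le> op_norm V N (D m c) * N e"
      unfolding D_def
      by (intro norm_le_op_norm bounded_op_sum bounded_op_scale bounded_op_diff bounded_op_funpow T e)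
    also have "\<dots> \<le> (K * (SUP n\<in>{1..m}. cmod (c n))) * N e"
      using K(2)[OF m] Ne by (intro mult_right_mono) auto
    also have "(SUP n\<in>{1..m}. cmod (c n)) = 1"
      using m a by (simp add: c_def norm_power)
    finally show ?thesis using Ne by simp
  qed
  have pos: "cmod (1 - cnj a) > 0"
    using \<open>a \<noteq> 1\<close> by (metis complex_cnj_cnj complex_cnj_one right_minus_eq zero_less_norm_iff)
  obtain m where m: "real m * cmod (1 - cnj a) > K"
    using reals_Archimedean3[OF pos] by blast
  have "real m * cmod (1 - cnj a) \<le> real (Suc m) * cmod (1 - cnj a)"
    by (intro mult_right_mono) auto
  with m *[of "Suc m"] show False by linarith
qed

text \<open>On an eigenvector the resolvent acts as 1/(l - a), so the growth condition forces |l -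
  1| <= M |l - a|. Letting \<open>l\<close> approach \<open>a\<close> radially from outside the disc
  contradicts this unless \<open>a = 1\<close>.\<close>

lemma ritt_resolvent_eigenvalue:
  assumes R: "ritt_resolvent_condition V N T"
    and e: "e \<in> V" "N e \<noteq> 0" "T e = (\<lambda>x. a * e x)" and a: "cmod a = 1"
  shows "a = 1"
proof (rule ccontr)
  assume "a \<noteq> 1"
  have T: "bounded_op V N T" using R by (simp add: ritt_resolvent_condition_def)
  obtain M where M: "M > 0" "\<And>l. cmod l > 1 \<Longrightarrow> op_norm V N (resolvent_op V T l) \<le> M / cmod (l - 1)"
    using R unfolding ritt_resolvent_condition_def by blast
  have Ne: "N e > 0" using e(2) norm_nonneg[of e] by simp
  have *: "cmod (l - 1) \<le> M * cmod (l - a)" if l: "cmod l > 1" for l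
  proof -
    have res: "bij_betw (\<lambda>f x. l * f x - T f x) V V" "bounded_op V N (resolvent_op V T l)"
      using R l by (auto simp: ritt_resolvent_condition_def resolvent_set_def)
    have l1: "cmod (l - 1) > 0" using l by auto
    have "resolvent_op V T l (\<lambda>x. l * e x - T e x) = e"
      unfolding resolvent_op_def using res(1) e(1) by (auto simp: bij_betw_def intro!: inv_into_f_f)
    moreover have "(\<lambda>x. l * e x - T e x) = (\<lambda>x. (l - a) * e x)"
      by (simp add: e(3) algebra_simps)
    ultimately have "N e \<le> op_norm V N (resolvent_op V T l) * N (\<lambda>x. (l - a) * e x)"
      using norm_le_op_norm[OF res(2) scale_mem[OF e(1)], of "l - a"] by simp
    also have "\<dots> \<le> (M / cmod (l - 1)) * (cmod (l - a) * N e)"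
      unfolding norm_scale using M(2)[OF l] Ne by (intro mult_right_mono) auto
    finally show ?thesis using Ne l1 by (simp add: field_simps)
  qed
  \<comment> \<open>Small enough that (M + 1) \<epsilon> is only half of |a - 1|, while the triangle
    inequality below makes it at least |a - 1|.\<close>
  define \<epsilon> where "\<epsilon> = cmod (a - 1) / (2 * (M + 1))"
  have \<epsilon>: "\<epsilon> > 0" using \<open>a \<noteq> 1\<close> M(1) by (simp add: \<epsilon>_def)
  define l where "l = (1 + of_real \<epsilon>) * a"
  have "cmod l = 1 + \<epsilon>"
    using a \<epsilon> unfolding l_def norm_mult
    by (metis abs_of_pos add_pos_pos mult.right_neutral norm_of_real of_real_1 of_real_add zero_less_one)
  moreover have la: "cmod (l - a) = \<epsilon>"
    using a \<epsilon> by (simp add: l_def algebra_simps norm_mult)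
  ultimately have "cmod (l - 1) \<le> M * \<epsilon>" using *[of l] \<epsilon> by simp
  moreover have "cmod (a - 1) \<le> cmod (l - 1) + cmod (l - a)"
    using norm_triangle_ineq4[of "l - 1" "l - a"] by simp
  ultimately have "cmod (a - 1) \<le> (M + 1) * \<epsilon>" using la by (simp add: algebra_simps)
  also have "\<dots> = cmod (a - 1) / 2" using M(1) by (simp add: \<epsilon>_def divide_simps)
  finally show False using \<open>a \<noteq> 1\<close> by simp
qed

section \<open>Sufficient criteria for the Ritt conditions\<close>

text \<open>The coefficients can be bounded by their supremum term by term, which leaves the sum of
  the norms of the differences; so \<open>suminf c\<close> serves as the constant. Here
  \<open>c n\<close> belongs to the difference that the condition numbers n + 1.\<close>

lemma unconditional_ritt_of_summable:
  assumes T: "bounded_op V N T" and c: "summable c" "\<And>n. 0 \<le> c n"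
    and bound: "\<And>n f. f \<in> V \<Longrightarrow> N (\<lambda>x. (T ^^ Suc n) f x - (T ^^ n) f x) \<le> c n * N f"
  shows "unconditional_ritt_condition V N T"
  unfolding unconditional_ritt_condition_def
proof (intro conjI T exI[of _ "suminf c"] allI impI)
  show "0 \<le> suminf c" using c by (rule suminf_nonneg)
  have mem: "(T ^^ n) f \<in> V" if "f \<in> V" for n f
    using bounded_op_funpow[OF T] that by (auto simp: bounded_op_def)
  fix m :: nat and a :: "nat \<Rightarrow> complex"
  assume m: "m \<ge> 1"
  define A where "A = (SUP n\<in>{1..m}. cmod (a n))"
  have A: "cmod (a n) \<le> A" if "n \<in> {1..m}" for n
    unfolding A_def using that by (intro cSUP_upper bdd_above_finite) auto
  have A0: "0 \<le> A" using order_trans[OF norm_ge_zero A[of 1]] m by simp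
  show "op_norm V N (\<lambda>f x. \<Sum>n = 1..m. a n * ((T ^^ n) f x - (T ^^ (n - 1)) f x)) \<le> suminf c * A"
  proof (rule op_norm_le)
    show "0 \<le> suminf c * A" using \<open>0 \<le> suminf c\<close> A0 by simp
    fix f assume f: "f \<in> V"
    have "N (\<lambda>x. \<Sum>n = 1..m. a n * ((T ^^ n) f x - (T ^^ (n - 1)) f x))
        \<le> (\<Sum>n = 1..m. N (\<lambda>x. a n * ((T ^^ n) f x - (T ^^ (n - 1)) f x)))"
      by (intro norm_sum scale_mem diff_mem mem f)
    also have "\<dots> \<le> (\<Sum>n = 1..m. A * (c (n - 1) * N f))"
    proof (rule sum_mono)
      fix n assume n: "n \<in> {1..m}"
      then have "N (\<lambda>x. (T ^^ n) f x - (T ^^ (n - 1)) f x) \<le> c (n - 1) * N f"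
        using bound[OF f, of "n - 1"] by simp
      then show "N (\<lambda>x. a n * ((T ^^ n) f x - (T ^^ (n - 1)) f x)) \<le> A * (c (n - 1) * N f)"
        unfolding norm_scale using A[OF n] A0 norm_nonneg by (intro mult_mono) auto
    qed
    also have "\<dots> = (\<Sum>n<m. c n) * (A * N f)"
      using sum.atLeast1_atMost_eq[of "\<lambda>n. A * (c (n - 1) * N f)" m]
      by (simp add: sum_distrib_left sum_distrib_right mult_ac)
    also have "\<dots> \<le> suminf c * (A * N f)"
      using c A0 norm_nonneg by (intro mult_right_mono sum_le_suminf) auto
    finally show "N (\<lambda>x. \<Sum>n = 1..m. a n * ((T ^^ n) f x - (T ^^ (n - 1)) f x)) \<le> suminf c * A * N f"
      by (simp add: mult.assoc)
  qed
qed

text \<open>A right inverse makes l - T surjective and \<open>inj\<close> makes it injective, so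
  \<open>R l\<close> is its inverse. Linearity of \<open>R l\<close> then follows by applying l - T
  to both sides and cancelling.\<close>

lemma ritt_resolvent_of_right_inverse:
  assumes T: "bounded_op V N T" and M: "M > 0"
    and R_mem: "\<And>l f. cmod l > 1 \<Longrightarrow> f \<in> V \<Longrightarrow> R l f \<in> V"
    and R_inverse: "\<And>l f. cmod l > 1 \<Longrightarrow> f \<in> V \<Longrightarrow> (\<lambda>x. l * R l f x - T (R l f) x) = f"
    and R_bound: "\<And>l f. cmod l > 1 \<Longrightarrow> f \<in> V \<Longrightarrow> N (R l f) \<le> M / cmod (l - 1) * N f"
    and inj: "\<And>l f. cmod l > 1 \<Longrightarrow> f \<in> V \<Longrightarrow> T f = (\<lambda>x. l * f x) \<Longrightarrow> f = (\<lambda>x. 0)"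
  shows "ritt_resolvent_condition V N T"
proof -
  have T_mem: "\<And>f. f \<in> V \<Longrightarrow> T f \<in> V"
    and T_add: "\<And>f g. f \<in> V \<Longrightarrow> g \<in> V \<Longrightarrow> T (\<lambda>x. f x + g x) = (\<lambda>x. T f x + T g x)"
    and T_scale: "\<And>f c. f \<in> V \<Longrightarrow> T (\<lambda>x. c * f x) = (\<lambda>x. c * T f x)"
    using T unfolding bounded_op_def by blast+
  have main: "l \<in> resolvent_set V N T \<and> op_norm V N (resolvent_op V T l) \<le> M / cmod (l - 1)"
    if l: "cmod l > 1" for l
  proof -
    define L where "L = (\<lambda>f x. l * f x - T f x)"
    have L_mem: "L f \<in> V" if "f \<in> V" for f
      unfolding L_def using that by (intro diff_mem scale_mem T_mem)
    have L_add: "L (\<lambda>x. f x + g x) = (\<lambda>x. L f x + L g x)" if "f \<in> V" "g \<in> V" for f g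
      by (simp add: L_def T_add that algebra_simps)
    have L_scale: "L (\<lambda>x. c * f x) = (\<lambda>x. c * L f x)" if "f \<in> V" for c f
      by (simp add: L_def T_scale that algebra_simps)
    have inj_L: "inj_on L V"
    proof (rule inj_onI)
      fix f g assume fg: "f \<in> V" "g \<in> V" "L f = L g"
      \<comment> \<open>The difference is written as a sum with a scalar multiple so that
        \<open>L_add\<close> and \<open>L_scale\<close> apply to it directly.\<close>
      let ?h = "\<lambda>x. f x + -1 * g x"
      have h: "?h \<in> V" using fg by (intro add_mem scale_mem)
      have "L ?h = (\<lambda>x. L f x + -1 * L g x)"
        using fg by (simp only: L_add L_scale scale_mem)
      then have "L ?h = (\<lambda>x. 0)" using fg(3) by simp
      then have "T ?h = (\<lambda>x. l * ?h x)"
        unfolding L_def by (metis (no_types, lifting) eq_iff_diff_eq_0)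
      from inj[OF l h this] show "f = g" by (simp add: fun_eq_iff)
    qed
    have L_R: "L (R l f) = f" if "f \<in> V" for f
      unfolding L_def by (rule R_inverse[OF l that])
    have bij: "bij_betw L V V"
    proof -
      have "f \<in> L ` V" if "f \<in> V" for f
        using image_eqI[of f L "R l f" V] L_R[OF that] R_mem[OF l that] by simp
      then show ?thesis unfolding bij_betw_def using inj_L L_mem by blast
    qed
    have res: "resolvent_op V T l f = R l f" if f: "f \<in> V" for f
      unfolding resolvent_op_def L_def[symmetric]
      using inv_into_f_f[OF inj_L R_mem[OF l f]] L_R[OF f] by simp
    have R_add: "R l (\<lambda>x. f x + g x) = (\<lambda>x. R l f x + R l g x)" if "f \<in> V" "g \<in> V" for f g
    proof (rule inj_onD[OF inj_L])
      show "L (R l (\<lambda>x. f x + g x)) = L (\<lambda>x. R l f x + R l g x)"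
        unfolding L_add[OF R_mem[OF l that(1)] R_mem[OF l that(2)]] L_R[OF that(1)] L_R[OF that(2)]
        by (rule L_R[OF add_mem[OF that]])
    qed (intro add_mem R_mem l that)+
    have R_scale: "R l (\<lambda>x. c * f x) = (\<lambda>x. c * R l f x)" if "f \<in> V" for c f
    proof (rule inj_onD[OF inj_L])
      show "L (R l (\<lambda>x. c * f x)) = L (\<lambda>x. c * R l f x)"
        unfolding L_scale[OF R_mem[OF l that]] L_R[OF that] by (rule L_R[OF scale_mem[OF that]])
    qed (intro scale_mem R_mem l that)+
    have "bounded_op V N (resolvent_op V T l)"
      unfolding bounded_op_def
    proof (intro conjI ballI allI exI[of _ "M / cmod (l - 1)"])
      show "N (resolvent_op V T l f) \<le> M / cmod (l - 1) * N f" if "f \<in> V" for f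
        using R_bound[OF l that] by (simp add: res that)
    qed (simp_all add: res R_mem[OF l] R_add R_scale add_mem scale_mem)
    moreover have "op_norm V N (resolvent_op V T l) \<le> M / cmod (l - 1)"
    proof (rule op_norm_le)
      show "N (resolvent_op V T l f) \<le> M / cmod (l - 1) * N f" if "f \<in> V" for f
        using R_bound[OF l that] by (simp add: res that)
    qed (use M in simp)
    ultimately show ?thesis
      using bij unfolding resolvent_set_def L_def by simp
  qed
  then show ?thesis
    unfolding ritt_resolvent_condition_def using T M by blast
qed

lemma ritt_conditions_identity:
  assumes T: "bounded_op V N T" and id: "\<And>f. f \<in> V \<Longrightarrow> T f = f"
  shows "ritt_resolvent_condition V N T" "unconditional_ritt_condition V N T"
proof -
  have l1: "l \<noteq> 1" if "cmod l > 1" for l using that by auto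
  show "ritt_resolvent_condition V N T"
  proof (rule ritt_resolvent_of_right_inverse[where M = 1 and R = "\<lambda>l f x. 1 / (l - 1) * f x"])
    fix l f assume l: "cmod l > 1" and f: "f \<in> V"
    show mem: "(\<lambda>x. 1 / (l - 1) * f x) \<in> V" by (rule scale_mem[OF f])
    show "(\<lambda>x. l * (1 / (l - 1) * f x) - T (\<lambda>x. 1 / (l - 1) * f x) x) = f"
    proof
      fix x
      have "l * (1 / (l - 1) * f x) - 1 / (l - 1) * f x = (l - 1) * (1 / (l - 1)) * f x"
        by (simp only: left_diff_distrib mult.assoc mult_1_left)
      then show "l * (1 / (l - 1) * f x) - T (\<lambda>x. 1 / (l - 1) * f x) x = f x"
        unfolding id[OF mem] using l1[OF l] by simp
    qed
    show "N (\<lambda>x. 1 / (l - 1) * f x) \<le> 1 / cmod (l - 1) * N f"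
      unfolding norm_scale by (simp add: norm_divide)
    assume "T f = (\<lambda>x. l * f x)"
    then have "f x = l * f x" for x using id[OF f] by metis
    then show "f = (\<lambda>x. 0)" using l1[OF l] by (auto simp: fun_eq_iff)
  qed (use T in auto)
  have "(T ^^ n) f = f" if "f \<in> V" for f n
    by (induction n) (simp_all add: id that)
  then show "unconditional_ritt_condition V N T"
    by (intro unconditional_ritt_of_summable[OF T, of "\<lambda>_. 0"]) (simp_all add: norm_zero id)
qed

section \<open>Compactness through sequences\<close>

text \<open>Compactness concerns the closure of the image of the ball, the hypothesis only the image
  itself. A sequence in the closure is replaced by images at distance below 1/(n+1); it then
  converges along the same subsequence to the same limit, which the closure contains.\<close>

lemma compact_op_of_subsequences:
  assumes T: "bounded_op V N T"
    and sub: "\<And>f. (\<And>n::nat. f n \<in> V \<and> N (f n) \<le> 1) \<Longrightarrow>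
      \<exists>g\<in>V. \<exists>r. strict_mono r \<and> (\<lambda>n. N (\<lambda>x. T (f (r n)) x - g x)) \<longlonglongrightarrow> 0"
  shows "compact_op V N T"
proof -
  define S where "S = T ` {f \<in> V. N f \<le> 1}"
  have "compactin metric.mtopology (metric.mtopology closure_of S)"
    unfolding metric.compactin_sequentially
  proof (intro conjI allI impI)
    show "metric.mtopology closure_of S \<subseteq> V"
      using closure_of_subset_topspace[of metric.mtopology S] by simp
    fix \<sigma> :: "nat \<Rightarrow> _" assume \<sigma>: "range \<sigma> \<subseteq> metric.mtopology closure_of S"
    have \<sigma>V: "\<sigma> n \<in> V" for n
      using \<sigma> closure_of_subset_topspace[of metric.mtopology S] by auto
    have "\<exists>f. f \<in> V \<and> N f \<le> 1 \<and> N (\<lambda>x. \<sigma> n x - T f x) < inverse (real (Suc n))" for n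
    proof -
      have "\<sigma> n \<in> metric.mtopology closure_of S" using \<sigma> by auto
      then have "\<exists>y\<in>S. y \<in> metric.mball (\<sigma> n) (inverse (real (Suc n)))"
        unfolding metric.metric_closure_of by simp
      then show ?thesis by (auto simp: S_def)
    qed
    then obtain f where f: "\<And>n. f n \<in> V" "\<And>n. N (f n) \<le> 1"
      "\<And>n. N (\<lambda>x. \<sigma> n x - T (f n) x) < inverse (real (Suc n))" by metis
    obtain g r where g: "g \<in> V" and r: "strict_mono r"
      and lim: "(\<lambda>n. N (\<lambda>x. T (f (r n)) x - g x)) \<longlonglongrightarrow> 0"
      using sub[of f] f by blast
    have TfV: "T (f n) \<in> V" for n using T f(1) by (simp add: bounded_op_def)
    have "(\<lambda>n. N (\<lambda>x. (\<sigma> \<circ> r) n x - g x)) \<longlonglongrightarrow> 0"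
    proof (rule Lim_null_comparison)
      show "\<forall>\<^sub>F n in sequentially. norm (N (\<lambda>x. (\<sigma> \<circ> r) n x - g x))
          \<le> inverse (real (Suc n)) + N (\<lambda>x. T (f (r n)) x - g x)"
      proof (rule always_eventually, rule allI)
        fix n
        have "N (\<lambda>x. (\<sigma> \<circ> r) n x - g x) \<le> N (\<lambda>x. \<sigma> (r n) x - T (f (r n)) x) + N (\<lambda>x. T (f (r n)) x - g x)"
          using metric.triangle[of "\<sigma> (r n)" "T (f (r n))" g] \<sigma>V TfV g by simp
        moreover have "inverse (real (Suc (r n))) \<le> inverse (real (Suc n))"
          using seq_suble[OF r, of n] by (simp add: le_imp_inverse_le)
        moreover have "N (\<lambda>x. \<sigma> (r n) x - T (f (r n)) x) < inverse (real (Suc (r n)))"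
          by (rule f(3))
        ultimately have "N (\<lambda>x. (\<sigma> \<circ> r) n x - g x) \<le> inverse (real (Suc n)) + N (\<lambda>x. T (f (r n)) x - g x)"
          by linarith
        then show "norm (N (\<lambda>x. (\<sigma> \<circ> r) n x - g x))
          \<le> inverse (real (Suc n)) + N (\<lambda>x. T (f (r n)) x - g x)"
          using norm_nonneg[of "\<lambda>x. (\<sigma> \<circ> r) n x - g x"] by (simp del: of_nat_Suc)
      qed
      show "(\<lambda>n. inverse (real (Suc n)) + N (\<lambda>x. T (f (r n)) x - g x)) \<longlonglongrightarrow> 0"
        using tendsto_add[OF LIMSEQ_inverse_real_of_nat lim] by simp
    qed
    then have lim\<sigma>: "limitin metric.mtopology (\<sigma> \<circ> r) g sequentially"
      unfolding metric.limitin_metric_dist_null using g \<sigma>V by simp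
    have "g \<in> metric.mtopology closure_of S"
    proof (rule limitin_closedin[OF lim\<sigma> closedin_closure_of])
      have "(\<sigma> \<circ> r) n \<in> metric.mtopology closure_of S" for n
        using subsetD[OF \<sigma> rangeI[of \<sigma> "r n"]] by simp
      then show "\<forall>\<^sub>F n in sequentially. (\<sigma> \<circ> r) n \<in> metric.mtopology closure_of S"
        by (intro always_eventually allI)
    qed simp
    with r lim\<sigma> show "\<exists>l r. l \<in> metric.mtopology closure_of S \<and> strict_mono r \<and>
        limitin metric.mtopology (\<sigma> \<circ> r) l sequentially" by blast
  qed
  then show ?thesis
    using T unfolding compact_op_def norm_topology_def S_def by simp
qed

lemma compact_op_subsequence:
  assumes "compact_op V N T" and f: "\<And>n::nat. f n \<in> V" "\<And>n. N (f n) \<le> 1"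
  obtains g r where "g \<in> V" "strict_mono r" "(\<lambda>n. N (\<lambda>x. T (f (r n)) x - g x)) \<longlonglongrightarrow> 0"
proof -
  define S where "S = T ` {f \<in> V. N f \<le> 1}"
  have T: "bounded_op V N T"
    and comp: "compactin metric.mtopology (metric.mtopology closure_of S)"
    using assms(1) unfolding compact_op_def norm_topology_def S_def by auto
  have SV: "S \<subseteq> V" using T by (auto simp: S_def bounded_op_def)
  then have "S \<subseteq> metric.mtopology closure_of S"
    by (intro closure_of_subset) simp
  then have "range (\<lambda>n. T (f n)) \<subseteq> metric.mtopology closure_of S"
    using f by (auto simp: S_def)
  then obtain g r where "g \<in> metric.mtopology closure_of S" "strict_mono r"
    "limitin metric.mtopology ((\<lambda>n. T (f n)) \<circ> r) g sequentially"
    using comp unfolding metric.compactin_sequentially by blast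
  then show ?thesis
    unfolding metric.limitin_metric_dist_null by (intro that[of g r]) simp_all
qed

end

section \<open>The Fock space\<close>

text \<open>The Gaussian is placed under the power \<open>p\<close>, so that everything depends on
  |f(z)| exp(-|z|^2/2), the quantity on which rotations, Weyl translations and pointwise majorants
  act transparently.\<close>

definition fock_integrand :: "real \<Rightarrow> (complex \<Rightarrow> complex) \<Rightarrow> complex \<Rightarrow> real" where
  "fock_integrand p f z = (cmod (f z) * exp (- ((cmod z)\<^sup>2 / 2))) powr p"

lemma fock_integrand_eq: "cmod (f z) powr p * exp (- (p * (cmod z)\<^sup>2 / 2)) = fock_integrand p f z"
  by (simp add: fock_integrand_def powr_mult exp_powr_real mult_ac)

lemma fock_space_iff:
  "f \<in> fock_space p \<longleftrightarrow> f holomorphic_on UNIV \<and> integrable lborel (fock_integrand p f)"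
  by (simp add: fock_space_def fock_integrand_eq)

lemma fock_norm_eq: "fock_norm p f = (p / (2 * pi) * (LINT z|lborel. fock_integrand p f z)) powr (1 / p)"
  by (simp add: fock_norm_def fock_integrand_eq)

lemma fock_integrand_nonneg: "0 \<le> fock_integrand p f z"
  by (simp add: fock_integrand_def)

lemma fock_norm_nonneg: "0 \<le> fock_norm p f"
  by (simp add: fock_norm_def)

lemma integral_fock_integrand_nonneg: "0 \<le> (LINT z|lborel. fock_integrand p f z)"
  by (simp add: fock_integrand_nonneg)

lemma integral_fock_integrand:
  assumes "p \<ge> 1"
  shows "(LINT z|lborel. fock_integrand p f z) = 2 * pi / p * fock_norm p f powr p"
  using assms integral_fock_integrand_nonneg[of p f] by (simp add: fock_norm_eq powr_powr)

lemma borel_measurable_fock_integrand [measurable]: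
  assumes [measurable]: "f \<in> borel_measurable borel"
  shows "fock_integrand p f \<in> borel_measurable borel"
  unfolding fock_integrand_def by measurable

lemma holomorphic_borel_measurable:
  "f holomorphic_on UNIV \<Longrightarrow> f \<in> borel_measurable borel"
  by (intro borel_measurable_continuous_onI holomorphic_on_imp_continuous_on)

lemma fock_integrand_scale:
  assumes "p \<ge> 1"
  shows "fock_integrand p (\<lambda>z. c * f z) z = cmod c powr p * fock_integrand p f z"
  by (simp add: fock_integrand_def norm_mult powr_mult mult_ac)

lemma fock_norm_scale:
  assumes "p \<ge> 1"
  shows "fock_norm p (\<lambda>z. c * f z) = cmod c * fock_norm p f"
proof -
  have "fock_norm p (\<lambda>z. c * f z)
      = (cmod c powr p * (p / (2 * pi) * (LINT z|lborel. fock_integrand p f z))) powr (1 / p)"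
    unfolding fock_norm_eq fock_integrand_scale[OF assms] by (simp add: mult_ac)
  also have "\<dots> = cmod c * fock_norm p f"
    unfolding fock_norm_eq using assms integral_fock_integrand_nonneg[of p f]
    by (subst powr_mult) (simp_all add: powr_powr)
  finally show ?thesis .
qed

lemma fock_space_scale:
  assumes "p \<ge> 1" "f \<in> fock_space p"
  shows "(\<lambda>z. c * f z) \<in> fock_space p"
  using assms unfolding fock_space_iff fock_integrand_scale[OF assms(1), abs_def]
  by (auto intro!: holomorphic_intros integrable_mult_right)

text \<open>The majorant \<open>g\<close> need not be holomorphic: it will be a real
  Gaussian.\<close>

lemma fock_norm_mono:
  assumes p: "p \<ge> 1" and g: "integrable lborel (fock_integrand p g)"
    and f: "f \<in> borel_measurable borel" and le: "\<And>z. cmod (f z) \<le> cmod (g z)"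
  shows "integrable lborel (fock_integrand p f)" "fock_norm p f \<le> fock_norm p g"
proof -
  have *: "fock_integrand p f z \<le> fock_integrand p g z" for z
    unfolding fock_integrand_def using p le by (intro powr_mono2 mult_right_mono) auto
  show int: "integrable lborel (fock_integrand p f)"
    using * f by (intro Bochner_Integration.integrable_bound[OF g])
      (auto intro!: always_eventually borel_measurable_fock_integrand simp: fock_integrand_nonneg)
  have "(LINT z|lborel. fock_integrand p f z) \<le> (LINT z|lborel. fock_integrand p g z)"
    using * by (intro integral_mono int g) auto
  then show "fock_norm p f \<le> fock_norm p g"
    unfolding fock_norm_eq using p integral_fock_integrand_nonneg[of p f]
    by (intro powr_mono2 mult_left_mono) auto
qed

text \<open>Convexity of the power is applied to positive arguments; when one argument vanishes the
  claim reduces to \<open>t powr p \<le> t\<close> for \<open>t\<close> in the unit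
  interval.\<close>

lemma powr_convex_combination:
  fixes p s t x y :: real
  assumes p: "p \<ge> 1" and st: "0 < s" "0 < t" "s + t = 1" and xy: "0 \<le> x" "0 \<le> y"
  shows "(s * x + t * y) powr p \<le> s * x powr p + t * y powr p"
proof -
  consider "x = 0" | "y = 0" | "x > 0" "y > 0" using xy by linarith
  then show ?thesis
  proof cases
    case 1
    then show ?thesis
      using p st powr_le_one_le[of t p] xy by (simp add: powr_mult mult_right_mono)
  next
    case 2
    then show ?thesis
      using p st powr_le_one_le[of s p] xy by (simp add: powr_mult mult_right_mono)
  next
    case 3
    have "1 - t = s" using st by simp
    with convex_onD[OF powr_convex[OF p], of t x y] 3 st show ?thesis by simp
  qed
qed

text \<open>Minkowski's inequality: divide \<open>f\<close> and \<open>g\<close> by numbers \<open>A\<close> and \<open>B\<close> strictly above their norms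
  (which may vanish) and apply the convexity of \<open>t powr p\<close> pointwise with the weights
  \<open>A / (A + B)\<close> and \<open>B / (A + B)\<close>.\<close>

lemma fock_add:
  assumes p: "p \<ge> 1" and f: "f \<in> fock_space p" and g: "g \<in> fock_space p"
  shows "(\<lambda>z. f z + g z) \<in> fock_space p" "fock_norm p (\<lambda>z. f z + g z) \<le> fock_norm p f + fock_norm p g"
proof -
  have int: "integrable lborel (fock_integrand p f)" "integrable lborel (fock_integrand p g)"
    and hol: "(\<lambda>z. f z + g z) holomorphic_on UNIV"
    using f g by (auto simp: fock_space_iff intro!: holomorphic_intros)
  have conv: "fock_integrand p (\<lambda>z. f z + g z) z \<le>
       (A + B) powr p * (A / (A + B) * (fock_integrand p f z / A powr p)
                       + B / (A + B) * (fock_integrand p g z / B powr p))"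
    if AB: "A > 0" "B > 0" for A B z
  proof -
    define u v w where "u = cmod (f z)" and "v = cmod (g z)" and "w = exp (- ((cmod z)\<^sup>2 / 2))"
    have nn: "0 \<le> u" "0 \<le> v" "0 < w" by (auto simp: u_def v_def w_def)
    have "cmod (f z + g z) * w \<le> (u + v) * w"
      using nn by (intro mult_right_mono) (auto simp: u_def v_def norm_triangle_ineq)
    also have "\<dots> = (A + B) * (A / (A + B) * (u * w / A) + B / (A + B) * (v * w / B))"
    proof -
      have "(A + B) * (A / (A + B) * s) = A * s" "(A + B) * (B / (A + B) * s) = B * s" for s
        using AB by (simp_all only: times_divide_eq_left times_divide_eq_right) simp_all
      then have "(A + B) * (A / (A + B) * (u * w / A) + B / (A + B) * (v * w / B))
          = A * (u * w / A) + B * (v * w / B)"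
        by (simp only: distrib_left)
      then show ?thesis using AB by (simp add: distrib_right)
    qed
    finally have "(cmod (f z + g z) * w) powr p \<le>
        ((A + B) * (A / (A + B) * (u * w / A) + B / (A + B) * (v * w / B))) powr p"
      using p nn by (intro powr_mono2) auto
    also have "\<dots> = (A + B) powr p * (A / (A + B) * (u * w / A) + B / (A + B) * (v * w / B)) powr p"
      using AB nn by (intro powr_mult)
    also have "(A / (A + B) * (u * w / A) + B / (A + B) * (v * w / B)) powr p
        \<le> A / (A + B) * (u * w / A) powr p + B / (A + B) * (v * w / B) powr p"
      using AB nn by (intro powr_convex_combination p) (simp_all flip: add_divide_distrib)
    also have "(u * w / A) powr p = (u * w) powr p / A powr p"
      using AB nn by (intro powr_divide)
    also have "(v * w / B) powr p = (v * w) powr p / B powr p"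
      using AB nn by (intro powr_divide)
    finally show ?thesis
      using AB by (simp add: fock_integrand_def u_def v_def w_def)
  qed
  define J where "J = (\<lambda>A B z. (A + B) powr p * (A / (A + B) * (fock_integrand p f z / A powr p)
                       + B / (A + B) * (fock_integrand p g z / B powr p)))"
  have J: "integrable lborel (J A B)" for A B
    unfolding J_def using int by (intro integrable_mult_right Bochner_Integration.integrable_add integrable_divide) auto
  \<comment> \<open>Integrability follows from any choice of positive weights;
    \<open>A = B = 1\<close> is taken. The sharp choice matters only for the norm.\<close>
  have int_sum: "integrable lborel (fock_integrand p (\<lambda>z. f z + g z))"
  proof (rule Bochner_Integration.integrable_bound[OF J[of 1 1]])
    show "AE z in lborel. norm (fock_integrand p (\<lambda>z. f z + g z) z) \<le> norm (J 1 1 z)"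
      using conv[of 1 1] by (intro always_eventually allI) (simp add: J_def fock_integrand_nonneg order_trans[OF _ abs_ge_self])
  qed (simp add: borel_measurable_fock_integrand holomorphic_borel_measurable[OF hol])
  then show "(\<lambda>z. f z + g z) \<in> fock_space p"
    using hol by (simp add: fock_space_iff)
  have le_pos: "fock_norm p (\<lambda>z. f z + g z) \<le> A + B"
    if AB: "A > fock_norm p f" "B > fock_norm p g" for A B
  proof -
    have pos: "A > 0" "B > 0" using AB fock_norm_nonneg[of p f] fock_norm_nonneg[of p g] by auto
    have f1: "(LINT z|lborel. fock_integrand p f z) / A powr p \<le> 2 * pi / p"
      unfolding integral_fock_integrand[OF p] using p pos AB fock_norm_nonneg[of p f]
      by (simp add: field_simps powr_mono2)
    have g1: "(LINT z|lborel. fock_integrand p g z) / B powr p \<le> 2 * pi / p"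
      unfolding integral_fock_integrand[OF p] using p pos AB fock_norm_nonneg[of p g]
      by (simp add: field_simps powr_mono2)
    have "(LINT z|lborel. fock_integrand p (\<lambda>z. f z + g z) z) \<le> (LINT z|lborel. J A B z)"
      using conv[OF pos] by (intro integral_mono int_sum J) (auto simp: J_def)
    also have "\<dots> = (A + B) powr p * (A / (A + B) * ((LINT z|lborel. fock_integrand p f z) / A powr p)
                       + B / (A + B) * ((LINT z|lborel. fock_integrand p g z) / B powr p))"
      unfolding J_def using int by simp
    also have "\<dots> \<le> (A + B) powr p * (A / (A + B) * (2 * pi / p) + B / (A + B) * (2 * pi / p))"
      using pos f1 g1 by (intro mult_left_mono add_mono) auto
    also have "\<dots> = (A + B) powr p * (2 * pi / p)"
      using pos by (simp flip: distrib_right add_divide_distrib)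
    finally have "fock_norm p (\<lambda>z. f z + g z) powr p \<le> (A + B) powr p"
      unfolding integral_fock_integrand[OF p] using p by (simp add: field_simps)
    then show ?thesis
      using powr_less_mono2[of p "A + B" "fock_norm p (\<lambda>z. f z + g z)"] p pos by fastforce
  qed
  show "fock_norm p (\<lambda>z. f z + g z) \<le> fock_norm p f + fock_norm p g"
  proof (rule field_le_epsilon)
    fix e :: real assume "e > 0"
    then show "fock_norm p (\<lambda>z. f z + g z) \<le> fock_norm p f + fock_norm p g + e"
      using le_pos[of "fock_norm p f + e / 2" "fock_norm p g + e / 2"] by simp
  qed
qed

text \<open>The Weyl translation: the exponential factor makes \<open>cmod (f z) * exp (- (cmod z)\<^sup>2 / 2)\<close>
  translation covariant. The translates of \<open>1\<close> are the normalized reproducing kernels.\<close>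

definition fock_shift :: "complex \<Rightarrow> (complex \<Rightarrow> complex) \<Rightarrow> complex \<Rightarrow> complex" where
  "fock_shift w f z = f (z + w) * exp (- cnj w * z - of_real ((cmod w)\<^sup>2 / 2))"

text \<open>The exponential factor of \<open>fock_shift\<close> has modulus exp(-Re(conj(w) z) -
  |w|^2/2), exactly what completes |z|^2 to |z + w|^2 in the weight.\<close>

lemma fock_integrand_shift: "fock_integrand p (fock_shift w f) z = fock_integrand p f (w + z)"
proof -
  have "(cmod (z + w))\<^sup>2 = (cmod z)\<^sup>2 + (cmod w)\<^sup>2 + 2 * Re (cnj w * z)"
    unfolding cmod_power2 by (simp add: power2_eq_square algebra_simps)
  then have "Re (- cnj w * z - of_real ((cmod w)\<^sup>2 / 2)) + - ((cmod z)\<^sup>2 / 2) = - ((cmod (z + w))\<^sup>2 / 2)"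
    by (simp add: field_simps)
  then have "cmod (fock_shift w f z) * exp (- ((cmod z)\<^sup>2 / 2)) = cmod (f (z + w)) * exp (- ((cmod (z + w))\<^sup>2 / 2))"
    unfolding fock_shift_def norm_mult norm_exp_eq_Re by (simp only: mult.assoc flip: exp_add)
  then show ?thesis by (simp add: fock_integrand_def add.commute)
qed

lemma nn_integral_fock_integrand_shift:
  assumes "f \<in> borel_measurable borel"
  shows "(\<integral>\<^sup>+z. fock_integrand p (fock_shift w f) z \<partial>lborel) = (\<integral>\<^sup>+z. fock_integrand p f z \<partial>lborel)"
  unfolding fock_integrand_shift using assms
  by (intro nn_integral_translate[of "\<lambda>z. ennreal (fock_integrand p f z)"]) measurable

lemma fock_shift:
  assumes f: "f \<in> fock_space p"
  shows "fock_shift w f \<in> fock_space p" "fock_norm p (fock_shift w f) = fock_norm p f"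
proof -
  have hol_f: "f holomorphic_on UNIV" and int: "integrable lborel (fock_integrand p f)"
    using f by (auto simp: fock_space_iff)
  have "(\<lambda>z. f (z + w)) holomorphic_on UNIV"
    using holomorphic_on_compose_gen[of "\<lambda>z. z + w" UNIV f UNIV, OF _ hol_f]
    by (simp add: o_def holomorphic_on_add holomorphic_on_ident)
  then have hol: "fock_shift w f holomorphic_on UNIV"
    unfolding fock_shift_def [abs_def] by (intro holomorphic_intros)
  have [measurable]: "f \<in> borel_measurable borel" "fock_shift w f \<in> borel_measurable borel"
    using hol hol_f by (auto intro: holomorphic_borel_measurable)
  have nn: "(\<integral>\<^sup>+z. fock_integrand p (fock_shift w f) z \<partial>lborel) = (\<integral>\<^sup>+z. fock_integrand p f z \<partial>lborel)"
    by (rule nn_integral_fock_integrand_shift) measurable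
  then show "fock_shift w f \<in> fock_space p"
    using int hol by (simp add: fock_space_iff integrable_iff_bounded fock_integrand_nonneg)
  show "fock_norm p (fock_shift w f) = fock_norm p f"
    unfolding fock_norm_eq by (simp add: integral_eq_nn_integral fock_integrand_nonneg nn)
qed

lemma fock_gaussian:
  assumes p: "p \<ge> 1" and q: "q < 1"
  shows "integrable lborel (fock_integrand p (\<lambda>z. of_real (exp (q * (cmod z)\<^sup>2 / 2))))"
proof -
  have "fock_integrand p (\<lambda>z. of_real (exp (q * (cmod z)\<^sup>2 / 2))) = (\<lambda>z. exp (- ((1 - q) * p / 2 * (cmod z)\<^sup>2)))"
    by (rule ext) (simp add: fock_integrand_def exp_powr_real field_simps flip: exp_add)
  then show ?thesis
    using integrable_gaussian_complex[of "(1 - q) * p / 2"] p q by simp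
qed

text \<open>The finite constant (for \<open>q < 1\<close>) by which a pointwise Gaussian bound turns
  into a norm bound.\<close>

definition fock_gauss_norm :: "real \<Rightarrow> real \<Rightarrow> real" where
  "fock_gauss_norm p q = fock_norm p (\<lambda>z. of_real (exp (q * (cmod z)\<^sup>2 / 2)))"

lemma fock_space_of_gaussian_bound:
  assumes p: "p \<ge> 1" and q: "q < 1" and f: "f holomorphic_on UNIV" and A: "0 \<le> A"
    and le: "\<And>z. cmod (f z) \<le> A * exp (q * (cmod z)\<^sup>2 / 2)"
  shows "f \<in> fock_space p" "fock_norm p f \<le> A * fock_gauss_norm p q"
proof -
  let ?g = "\<lambda>z. of_real A * complex_of_real (exp (q * (cmod z)\<^sup>2 / 2))"
  have g: "integrable lborel (fock_integrand p ?g)"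
    unfolding fock_integrand_scale[OF p, abs_def] by (intro integrable_mult_right fock_gaussian p q)
  have le': "cmod (f z) \<le> cmod (?g z)" for z
    using le[of z] A by (simp add: norm_mult)
  note * = fock_norm_mono[OF p g holomorphic_borel_measurable[OF f] le']
  show "f \<in> fock_space p" using *(1) f by (simp add: fock_space_iff)
  show "fock_norm p f \<le> A * fock_gauss_norm p q"
    using *(2) A unfolding fock_norm_scale[OF p] fock_gauss_norm_def by simp
qed

text \<open>Average the mean value property over all circles, with Gaussian weight; the elementary
  \<open>u \<le> 1 + u powr p\<close> replaces Jensen's inequality.\<close>

lemma fock_evaluation_0:
  assumes p: "p \<ge> 1"
  obtains C where "C > 0" "\<And>f. f \<in> fock_space p \<Longrightarrow> cmod (f 0) \<le> C * fock_norm p f"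
proof -
  define W where "W = (\<lambda>z::complex. exp (- (p / 2 * (cmod z)\<^sup>2)))"
  have W_nonneg: "0 \<le> W z" for z by (simp add: W_def)
  have [measurable]: "W \<in> borel_measurable borel" unfolding W_def by measurable
  have W_int: "integrable lborel W"
    unfolding W_def using integrable_gaussian_complex[of "p / 2"] p by simp
  define g where "g = (LINT z|lborel. W z)"
  have G: "(\<integral>\<^sup>+z. ennreal (W z) \<partial>lborel) = ennreal g"
    unfolding g_def using W_int by (intro nn_integral_eq_integral) (auto simp: W_nonneg)
  have g: "g > 0"
  proof -
    have "(\<integral>\<^sup>+z. ennreal (W z) \<partial>lborel) \<noteq> 0"
    proof
      assume "(\<integral>\<^sup>+z. ennreal (W z) \<partial>lborel) = 0"
      then have "AE z in lborel. ennreal (W z) = 0" by (simp add: nn_integral_0_iff_AE)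
      then have "AE z::complex in lborel. False" by (simp add: W_def ennreal_eq_0_iff not_le)
      then show False by (simp add: ae_filter_eq_bot_iff AE_iff_null)
    qed
    then show ?thesis unfolding G by (simp add: ennreal_eq_0_iff not_le)
  qed
  \<comment> \<open>\<open>g\<close> is the total mass of the weight and 2 pi / p bounds the
    integral of \<open>fock_integrand p f\<close> over the unit ball of the space; the quotient is
    the averaged bound for 1 + |f|^p.\<close>
  define C where "C = (g + 2 * pi / p) / g"
  have unit: "cmod (f 0) \<le> C" if f: "f \<in> fock_space p" and N: "fock_norm p f \<le> 1" for f
  proof -
    have hol: "f holomorphic_on UNIV" and int: "integrable lborel (fock_integrand p f)"
      using f by (auto simp: fock_space_iff)
    have [measurable]: "f \<in> borel_measurable borel" by (rule holomorphic_borel_measurable[OF hol])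
    define H where "H = (\<lambda>z. ennreal (W z + fock_integrand p f z))"
    have H [measurable]: "H \<in> borel_measurable borel" unfolding H_def by measurable
    \<comment> \<open>The weight is radial, so both terms can be evaluated at the rotated point
      \<open>e * z\<close>; this makes the right-hand side \<open>H\<close> composed with a
      rotation.\<close>
    have le_H: "cmod (f (z * e)) * W z \<le> W (e * z) + fock_integrand p f (e * z)" if e: "cmod e = 1" for e z
    proof -
      let ?u = "cmod (f (z * e))"
      have "?u \<le> 1 + ?u powr p"
      proof (cases "?u \<le> 1")
        case True
        then show ?thesis using powr_ge_zero[of ?u p] by linarith
      next
        case False
        then show ?thesis using powr_mono[OF p, of ?u] by simp
      qed
      then have "?u * W z \<le> (1 + ?u powr p) * W z"
        by (intro mult_right_mono W_nonneg)
      also have "\<dots> = W (e * z) + fock_integrand p f (e * z)"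
        using e by (simp add: W_def fock_integrand_eq[symmetric] norm_mult distrib_right mult.commute[of z e])
      finally show ?thesis .
    qed
    have Hint: "(\<integral>\<^sup>+z. H z \<partial>lborel) \<le> ennreal (g + 2 * pi / p)"
    proof -
      have "(\<integral>\<^sup>+z. H z \<partial>lborel) = ennreal (LINT z|lborel. W z + fock_integrand p f z)"
        unfolding H_def using W_int int
        by (intro nn_integral_eq_integral) (auto simp: W_nonneg fock_integrand_nonneg)
      also have "(LINT z|lborel. W z + fock_integrand p f z) = g + 2 * pi / p * fock_norm p f powr p"
        using W_int int by (simp add: g_def integral_fock_integrand[OF p])
      also have "\<dots> \<le> g + 2 * pi / p * 1"
        using N p fock_norm_nonneg[of p f] by (intro add_left_mono mult_left_mono powr_le1) auto
      finally show ?thesis by (simp add: ennreal_leI)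
    qed
    have "ennreal (cmod (f 0)) * ennreal g = (\<integral>\<^sup>+z. ennreal (cmod (f 0)) * ennreal (W z) \<partial>lborel)"
      by (subst nn_integral_cmult) (simp_all add: G)
    also have "\<dots> \<le> (\<integral>\<^sup>+z. \<integral>\<^sup>+t. indicator {0..1} t * H (cis (2 * pi * t) * z) \<partial>lborel \<partial>lborel)"
    proof (rule nn_integral_mono)
      fix z :: complex
      have [measurable]: "(\<lambda>t. f (z * cis (2 * pi * t))) \<in> borel_measurable borel"
        unfolding cis.ctr by measurable
      have "ennreal (cmod (f 0)) * ennreal (W z)
          \<le> (\<integral>\<^sup>+t. ennreal (indicator {0..1} t * cmod (f (z * cis (2 * pi * t)))) \<partial>lborel) * ennreal (W z)"
        by (intro mult_right_mono mean_value_bound hol) simp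
      also have "\<dots> = (\<integral>\<^sup>+t. ennreal (indicator {0..1} t * cmod (f (z * cis (2 * pi * t)))) * ennreal (W z) \<partial>lborel)"
        by (subst nn_integral_multc) simp_all
      also have "\<dots> \<le> (\<integral>\<^sup>+t. indicator {0..1} t * H (cis (2 * pi * t) * z) \<partial>lborel)"
        using le_H[of "cis _" z]
        by (intro nn_integral_mono) (auto simp: H_def W_nonneg ennreal_mult[symmetric] indicator_def intro!: ennreal_leI)
      finally show "ennreal (cmod (f 0)) * ennreal (W z) \<le> (\<integral>\<^sup>+t. indicator {0..1} t * H (cis (2 * pi * t) * z) \<partial>lborel)" .
    qed
    \<comment> \<open>After the exchange of integrals the angle \<open>t\<close> is fixed in the
      inner one, where rotation invariance removes it.\<close>
    also have "\<dots> = (\<integral>\<^sup>+t. \<integral>\<^sup>+z. indicator {0..1} t * H (cis (2 * pi * t) * z) \<partial>lborel \<partial>lborel)"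
      unfolding cis.ctr by (rule lborel_pair.Fubini') measurable
    also have "\<dots> = (\<integral>\<^sup>+t. indicator {0..1::real} t * (\<integral>\<^sup>+z. H z \<partial>lborel) \<partial>lborel)"
    proof (rule nn_integral_cong)
      fix t :: real
      have "(\<integral>\<^sup>+z. indicator {0..1} t * H (cis (2 * pi * t) * z) \<partial>lborel)
          = indicator {0..1} t * (\<integral>\<^sup>+z. H (cis (2 * pi * t) * z) \<partial>lborel)"
        by (rule nn_integral_cmult) measurable
      then show "(\<integral>\<^sup>+z. indicator {0..1} t * H (cis (2 * pi * t) * z) \<partial>lborel)
          = indicator {0..1} t * (\<integral>\<^sup>+z. H z \<partial>lborel)"
        by (simp add: nn_integral_rotate[OF H])
    qed
    also have "\<dots> = (\<integral>\<^sup>+z. H z \<partial>lborel)"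
      by (subst nn_integral_multc) simp_all
    finally have "ennreal (cmod (f 0) * g) \<le> ennreal (g + 2 * pi / p)"
      using Hint g by (simp add: ennreal_mult)
    then have "cmod (f 0) * g \<le> g + 2 * pi / p"
      using g p by (subst (asm) ennreal_le_iff) auto
    then show ?thesis using g by (simp add: C_def field_simps)
  qed
  have C: "C > 0" using g p by (auto simp: C_def intro!: divide_pos_pos add_pos_pos)
  moreover have "cmod (f 0) \<le> C * fock_norm p f" if f: "f \<in> fock_space p" for f
  proof -
    \<comment> \<open>Scaling by any \<open>s\<close> strictly above the norm avoids dividing by a
      norm that might vanish: definiteness is itself deduced from point evaluations later.\<close>
    have "cmod (f 0) / C \<le> fock_norm p f"
    proof (rule dense_ge)
      fix s assume s: "fock_norm p f < s"
      then have s0: "s > 0" using fock_norm_nonneg[of p f] by linarith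
      have "cmod (of_real (1 / s) * f 0) \<le> C"
      proof (rule unit[of "\<lambda>z. of_real (1 / s) * f z"])
        show "fock_norm p (\<lambda>z. of_real (1 / s) * f z) \<le> 1"
          unfolding fock_norm_scale[OF p] using s s0 by (simp add: norm_divide)
      qed (rule fock_space_scale[OF p f])
      then show "cmod (f 0) / C \<le> s" using s0 C by (simp add: norm_divide field_simps)
    qed
    then show ?thesis using C by (simp add: field_simps)
  qed
  ultimately show ?thesis by (rule that)
qed

text \<open>The translate of \<open>f\<close> by \<open>w\<close> has the same norm, and its value
  at 0 is f(w) exp(-|w|^2/2).\<close>

lemma fock_evaluation:
  assumes p: "p \<ge> 1"
  obtains C where "C > 0" "\<And>f z. f \<in> fock_space p \<Longrightarrow> cmod (f z) \<le> C * fock_norm p f * exp ((cmod z)\<^sup>2 / 2)"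
proof -
  obtain C where C: "C > 0" "\<And>f. f \<in> fock_space p \<Longrightarrow> cmod (f 0) \<le> C * fock_norm p f"
    using fock_evaluation_0[OF p] by blast
  have "cmod (f w) \<le> C * fock_norm p f * exp ((cmod w)\<^sup>2 / 2)" if f: "f \<in> fock_space p" for f w
  proof -
    have "cmod (f w) * exp (- ((cmod w)\<^sup>2 / 2)) \<le> C * fock_norm p f"
      using C(2)[OF fock_shift(1)[OF f], of w] unfolding fock_shift(2)[OF f]
      by (simp add: fock_shift_def norm_mult norm_exp_eq_Re)
    then show ?thesis by (simp add: exp_minus divide_simps)
  qed
  with C(1) show ?thesis by (intro that)
qed

text \<open>The kernel is the constant 1 translated by \<open>- w\<close> and rescaled by
  exp(|w|^2/2), and translation is isometric.\<close>

lemma fock_kernel: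
  assumes p: "p \<ge> 1"
  shows "(\<lambda>z. exp (cnj w * z)) \<in> fock_space p"
    and "fock_norm p (\<lambda>z. exp (cnj w * z)) = exp ((cmod w)\<^sup>2 / 2) * fock_norm p (\<lambda>z. 1)"
proof -
  have 1: "(\<lambda>z. 1) \<in> fock_space p"
    using fock_space_of_gaussian_bound(1)[OF p, of 0 "\<lambda>z. 1" 1] by simp
  have eq: "(\<lambda>z. exp (cnj w * z)) = (\<lambda>z. of_real (exp ((cmod w)\<^sup>2 / 2)) * fock_shift (- w) (\<lambda>z. 1) z)"
    by (rule ext) (simp add: fock_shift_def exp_diff flip: exp_of_real)
  show "(\<lambda>z. exp (cnj w * z)) \<in> fock_space p"
    unfolding eq by (intro fock_space_scale[OF p] fock_shift 1)
  show "fock_norm p (\<lambda>z. exp (cnj w * z)) = exp ((cmod w)\<^sup>2 / 2) * fock_norm p (\<lambda>z. 1)"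
    unfolding eq fock_norm_scale[OF p] by (simp add: fock_shift(2)[OF 1])
qed

lemma function_space_norm_fock:
  assumes p: "p \<ge> 1"
  shows "function_space_norm (fock_space p) (fock_norm p)"
proof
  show "(\<lambda>z. 0) \<in> fock_space p"
    using fock_space_of_gaussian_bound(1)[OF p, of 0 "\<lambda>z. 0" 0] by simp
  fix f assume "f \<in> fock_space p" "fock_norm p f = 0"
  moreover obtain C where "C > 0" "\<And>f z. f \<in> fock_space p \<Longrightarrow> cmod (f z) \<le> C * fock_norm p f * exp ((cmod z)\<^sup>2 / 2)"
    using fock_evaluation[OF p] by blast
  ultimately have "cmod (f z) \<le> 0" for z by (metis mult_zero_left mult_zero_right)
  then show "f = (\<lambda>z. 0)" by auto
qed (use fock_add fock_space_scale fock_norm_scale fock_norm_nonneg p in auto)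

section \<open>Symbols of bounded composition operators\<close>

text \<open>Test the operator on the kernel at \<open>\<psi> z\<close> and evaluate at \<open>z\<close>.\<close>

lemma comp_op_symbol_growth:
  assumes p: "p \<ge> 1" and T: "bounded_op (fock_space p) (fock_norm p) (comp_op \<psi>)"
  obtains K where "K \<ge> 0" "\<And>z. (cmod (\<psi> z))\<^sup>2 \<le> (cmod z)\<^sup>2 + K"
proof -
  interpret F: function_space_norm "fock_space p" "fock_norm p"
    by (rule function_space_norm_fock[OF p])
  obtain C where C: "C > 0"
    "\<And>f z. f \<in> fock_space p \<Longrightarrow> cmod (f z) \<le> C * fock_norm p f * exp ((cmod z)\<^sup>2 / 2)"
    using fock_evaluation[OF p] by blast
  obtain D where D: "0 \<le> D" "\<And>f. f \<in> fock_space p \<Longrightarrow> fock_norm p (comp_op \<psi> f) \<le> D * fock_norm p f"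
    using F.bounded_op_nonneg_bound[OF T] by blast
  \<comment> \<open>The maximum with 1 makes \<open>ln M\<close> nonnegative, as the conclusion
    \<open>K \<ge> 0\<close> requires.\<close>
  define M where "M = max 1 (C * D * fock_norm p (\<lambda>z. 1))"
  have M: "M \<ge> 1" by (simp add: M_def)
  have "(cmod (\<psi> z))\<^sup>2 \<le> (cmod z)\<^sup>2 + 2 * ln M" for z
  proof -
    let ?w = "\<psi> z"
    let ?k = "\<lambda>u. exp (cnj ?w * u)"
    have k: "?k \<in> fock_space p" and Nk: "fock_norm p ?k = exp ((cmod ?w)\<^sup>2 / 2) * fock_norm p (\<lambda>z. 1)"
      using fock_kernel[OF p] by blast+
    have Tk: "comp_op \<psi> ?k \<in> fock_space p" using T k by (simp add: bounded_op_def)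
    have "exp ((cmod ?w)\<^sup>2) = cmod (comp_op \<psi> ?k z)"
      unfolding cmod_power2 by (simp add: comp_op_def power2_eq_square)
    also have "\<dots> \<le> C * fock_norm p (comp_op \<psi> ?k) * exp ((cmod z)\<^sup>2 / 2)"
      by (rule C(2)[OF Tk])
    also have "\<dots> \<le> C * (D * fock_norm p ?k) * exp ((cmod z)\<^sup>2 / 2)"
      using C(1) D(2)[OF k] by (intro mult_right_mono mult_left_mono) auto
    also have "\<dots> = (C * D * fock_norm p (\<lambda>z. 1)) * (exp ((cmod ?w)\<^sup>2 / 2) * exp ((cmod z)\<^sup>2 / 2))"
      unfolding Nk by (simp add: mult_ac)
    also have "\<dots> \<le> M * (exp ((cmod ?w)\<^sup>2 / 2) * exp ((cmod z)\<^sup>2 / 2))"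
      by (intro mult_right_mono) (auto simp: M_def)
    also have "M = exp (ln M)" using M by simp
    finally have "(cmod ?w)\<^sup>2 \<le> ln M + ((cmod ?w)\<^sup>2 / 2 + (cmod z)\<^sup>2 / 2)"
      by (simp flip: exp_add)
    then show ?thesis by simp
  qed
  then show ?thesis using M by (intro that[of "2 * ln M"]) auto
qed

text \<open>The hypothesis gives linear growth outside the unit disc, and Liouville's theorem for
  polynomial growth of degree 1 finishes.\<close>

lemma affine_of_growth:
  assumes hol: "\<psi> holomorphic_on UNIV" and K: "K \<ge> 0" "\<And>z. (cmod (\<psi> z))\<^sup>2 \<le> (cmod z)\<^sup>2 + K"
  obtains a b where "\<psi> = (\<lambda>z. a * z + b)"
proof -
  have "cmod (\<psi> z) \<le> (1 + sqrt K) * cmod z ^ 1" if z: "1 \<le> cmod z" for z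
  proof -
    have "K * 1 \<le> K * (cmod z)\<^sup>2"
      using z K(1) by (intro mult_left_mono) (auto simp: one_le_power)
    moreover have "0 \<le> sqrt K * (cmod z)\<^sup>2" using K(1) by simp
    moreover have "((1 + sqrt K) * cmod z)\<^sup>2 = (cmod z)\<^sup>2 + 2 * (sqrt K * (cmod z)\<^sup>2) + K * (cmod z)\<^sup>2"
      using K(1) unfolding power_mult_distrib power2_sum by (simp add: distrib_right)
    ultimately have "(cmod (\<psi> z))\<^sup>2 \<le> ((1 + sqrt K) * cmod z)\<^sup>2"
      using K(2)[of z] by linarith
    then have "cmod (\<psi> z) \<le> (1 + sqrt K) * cmod z"
      by (rule power2_le_imp_le) (use K(1) in simp)
    then show ?thesis by simp
  qed
  note * = Liouville_polynomial[OF hol this]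
  define a b where "a = deriv \<psi> 0" and "b = \<psi> 0"
  have "(\<Sum>k\<le>1. (deriv ^^ k) \<psi> 0 / fact k * z ^ k) = a * z + b" for z
    unfolding a_def b_def One_nat_def sum.atMost_Suc by simp
  with * have "\<psi> z = a * z + b" for z by (rule trans)
  then have "\<psi> = (\<lambda>z. a * z + b)" by (rule ext)
  then show ?thesis by (rule that)
qed

text \<open>If |a| >= 1, points z with a z parallel to b produce a cross term that no constant
  \<open>K\<close> dominates, so b = 0. Once b = 0, large real z exclude |a| > 1.\<close>

lemma affine_growth_coefficients:
  assumes K: "K \<ge> 0" "\<And>z. (cmod (a * z + b))\<^sup>2 \<le> (cmod z)\<^sup>2 + K"
  shows "cmod a \<le> 1" "cmod a = 1 \<Longrightarrow> b = 0"
proof -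
  have b: "b = 0" if a: "cmod a \<ge> 1"
  proof (rule ccontr)
    assume "b \<noteq> 0"
    define r where "r = cmod a"
    \<comment> \<open>Chosen so that the surplus t |b|^2 equals K + 1; the point \<open>z\<close>
      below makes a z equal to t |a|^2 b.\<close>
    define t where "t = (K + 1) / (cmod b)\<^sup>2"
    have t: "t \<ge> 0" using K(1) by (simp add: t_def)
    have r: "r \<ge> 1" using a by (simp add: r_def)
    define z where "z = of_real t * cnj a * b"
    have "a * z + b = of_real (t * r\<^sup>2 + 1) * b"
      unfolding z_def r_def of_real_add of_real_mult of_real_1 complex_norm_square
      by (simp add: distrib_left distrib_right mult_ac)
    then have "(cmod (a * z + b))\<^sup>2 = (t * r\<^sup>2 + 1)\<^sup>2 * (cmod b)\<^sup>2"
      by (simp add: norm_mult power_mult_distrib del: of_real_add)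
    also have "(t * r\<^sup>2 + 1)\<^sup>2 \<ge> (t * r)\<^sup>2 + t"
    proof -
      have "r * 1 \<le> r * r" using r by (intro mult_left_mono) auto
      then have "t * r \<le> t * r\<^sup>2" using t by (intro mult_left_mono) (auto simp: power2_eq_square)
      then have "(t * r)\<^sup>2 \<le> (t * r\<^sup>2)\<^sup>2" using t r by (intro power_mono) auto
      moreover have "t * 1 \<le> t * r\<^sup>2" using t r by (intro mult_left_mono) auto
      moreover have "(t * r\<^sup>2 + 1)\<^sup>2 = (t * r\<^sup>2)\<^sup>2 + 2 * (t * r\<^sup>2) + 1" by (simp add: power2_sum)
      ultimately show ?thesis using t by linarith
    qed
    then have "(t * r\<^sup>2 + 1)\<^sup>2 * (cmod b)\<^sup>2 \<ge> ((t * r)\<^sup>2 + t) * (cmod b)\<^sup>2"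
      by (intro mult_right_mono) auto
    finally have "((t * r)\<^sup>2 + t) * (cmod b)\<^sup>2 \<le> (cmod z)\<^sup>2 + K"
      using K(2)[of z] by linarith
    moreover have "(cmod z)\<^sup>2 = (t * r)\<^sup>2 * (cmod b)\<^sup>2"
      by (simp add: z_def norm_mult r_def power_mult_distrib)
    ultimately have "t * (cmod b)\<^sup>2 \<le> K" by (simp add: distrib_right)
    then show False using \<open>b \<noteq> 0\<close> by (simp add: t_def)
  qed
  then show "cmod a = 1 \<Longrightarrow> b = 0" by simp
  show "cmod a \<le> 1"
  proof (rule ccontr)
    assume "\<not> cmod a \<le> 1"
    then have a: "cmod a > 1" by simp
    then have pos: "(cmod a)\<^sup>2 - 1 > 0" by simp
    \<comment> \<open>Here the surplus (|a|^2 - 1) t^2 equals K + 1.\<close>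
    define t where "t = sqrt ((K + 1) / ((cmod a)\<^sup>2 - 1))"
    have t2: "t\<^sup>2 = (K + 1) / ((cmod a)\<^sup>2 - 1)" using pos K(1) by (simp add: t_def)
    have "(cmod a)\<^sup>2 * t\<^sup>2 \<le> t\<^sup>2 + K"
      using K(2)[of "of_real t"] b a by (simp add: norm_mult power_mult_distrib)
    then have "((cmod a)\<^sup>2 - 1) * t\<^sup>2 \<le> K" by (simp add: left_diff_distrib)
    then show False using pos by (simp add: t2)
  qed
qed

text \<open>In the applications \<open>t\<close> is |z| and \<open>r\<close> bounds the modulus
  where the function is evaluated after one contraction. The factor \<open>t + d\<close> is at most
  \<open>exp (t + d)\<close>, and all linear terms of the exponent are absorbed by completing a
  square.\<close>

lemma gaussian_absorbs_linear:
  fixes s c d :: real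
  assumes s: "0 \<le> s" "s < 1" and c: "0 \<le> c" and d: "0 \<le> d"
  shows "\<exists>q A. q < 1 \<and> A > 0 \<and>
    (\<forall>r t. 0 \<le> r \<longrightarrow> 0 \<le> t \<longrightarrow> r \<le> s * t + c \<longrightarrow> exp (r\<^sup>2 / 2) * (t + d) \<le> A * exp (q * t\<^sup>2 / 2))"
proof -
  have s2: "s\<^sup>2 < 1" using s by (simp add: abs_square_less_1)
  \<comment> \<open>\<open>q\<close> lies halfway between s^2 and 1. Then \<open>\<alpha>\<close> is
    the spare coefficient of t^2, \<open>\<beta>\<close> the total coefficient of t, and
    \<beta>^2/(4 \<alpha>) the maximum of \<beta> t - \<alpha> t^2.\<close>
  define \<alpha> \<beta> q A where "\<alpha> = (1 - s\<^sup>2) / 4" and "\<beta> = 1 + s * c" and "q = (1 + s\<^sup>2) / 2"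
    and "A = exp (d + c\<^sup>2 / 2 + \<beta>\<^sup>2 / (4 * \<alpha>))"
  have \<alpha>: "\<alpha> > 0" using s2 by (simp add: \<alpha>_def)
  have bound: "exp (r\<^sup>2 / 2) * (t + d) \<le> A * exp (q * t\<^sup>2 / 2)" if "0 \<le> r" "0 \<le> t" "r \<le> s * t + c" for r t
  proof -
    have "0 \<le> (2 * \<alpha> * t - \<beta>)\<^sup>2 / (4 * \<alpha>)" using \<alpha> by simp
    also have "\<dots> = \<alpha> * t\<^sup>2 - \<beta> * t + \<beta>\<^sup>2 / (4 * \<alpha>)"
      using \<alpha> by (simp add: field_simps power2_eq_square)
    finally have quad: "\<beta> * t - \<alpha> * t\<^sup>2 \<le> \<beta>\<^sup>2 / (4 * \<alpha>)" by simp
    have "r\<^sup>2 / 2 + (t + d) \<le> (s * t + c)\<^sup>2 / 2 + (t + d)"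
      using that by (intro add_right_mono divide_right_mono power_mono) auto
    also have "\<dots> = d + c\<^sup>2 / 2 + (\<beta> * t - \<alpha> * t\<^sup>2) + q * t\<^sup>2 / 2"
      by (simp add: \<alpha>_def \<beta>_def q_def field_simps power2_eq_square)
    also have "\<dots> \<le> d + c\<^sup>2 / 2 + \<beta>\<^sup>2 / (4 * \<alpha>) + q * t\<^sup>2 / 2"
      using quad by simp
    finally have "exp (r\<^sup>2 / 2 + (t + d)) \<le> A * exp (q * t\<^sup>2 / 2)"
      unfolding A_def by (simp flip: exp_add)
    moreover have "exp (r\<^sup>2 / 2) * (t + d) \<le> exp (r\<^sup>2 / 2) * exp (t + d)"
      using exp_ge_add_one_self[of "t + d"] by (intro mult_left_mono) (linarith, simp)
    ultimately show ?thesis by (simp only: exp_add)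
  qed
  show ?thesis
  proof (rule exI[of _ q], rule exI[of _ A], intro conjI allI impI bound)
    show "q < 1" "A > 0" using s2 by (simp_all add: q_def A_def)
  qed
qed

lemma fock_ident:
  assumes p: "p \<ge> 1"
  shows "(\<lambda>z. z) \<in> fock_space p"
proof -
  have *: "cmod z \<le> 1 * exp (1 / 2 * (cmod z)\<^sup>2 / 2)" for z :: complex
  proof -
    have "0 \<le> (cmod z / 2 - 1)\<^sup>2" by simp
    then have "cmod z \<le> 1 + (cmod z)\<^sup>2 / 4"
      by (simp add: power2_diff power_divide)
    also have "\<dots> \<le> exp ((cmod z)\<^sup>2 / 4)" by (rule exp_ge_add_one_self)
    finally show ?thesis by simp
  qed
  show ?thesis
    by (rule fock_space_of_gaussian_bound(1)[OF p, of "1 / 2" "\<lambda>z. z" 1])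
      (use * in \<open>simp_all add: holomorphic_on_ident\<close>)
qed

lemma fock_one:
  assumes p: "p \<ge> 1"
  shows "(\<lambda>z. 1) \<in> fock_space p" "fock_norm p (\<lambda>z. 1) > 0"
proof -
  interpret F: function_space_norm "fock_space p" "fock_norm p"
    by (rule function_space_norm_fock[OF p])
  show 1: "(\<lambda>z. 1) \<in> fock_space p"
    using fock_kernel(1)[OF p, of 0] by simp
  show "fock_norm p (\<lambda>z. 1) > 0"
    using F.norm_eq_0[OF 1] F.norm_nonneg[of "\<lambda>z. 1"] by (auto simp: fun_eq_iff less_le)
qed

lemma fock_norm_rotate:
  assumes f: "f \<in> fock_space p" and a: "cmod a = 1"
  shows "fock_norm p (\<lambda>z. f (a * z)) = fock_norm p f"
proof -
  have [measurable]: "f \<in> borel_measurable borel"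
    using f by (auto simp: fock_space_iff intro: holomorphic_borel_measurable)
  have *: "fock_integrand p (\<lambda>z. f (a * z)) z = fock_integrand p f (a * z)" for z
    using a by (simp add: fock_integrand_def norm_mult)
  have "(\<integral>\<^sup>+z. fock_integrand p f (a * z) \<partial>lborel) = (\<integral>\<^sup>+z. fock_integrand p f z \<partial>lborel)"
    by (rule nn_integral_rotate[OF _ a, of "\<lambda>z. ennreal (fock_integrand p f z)"]) measurable
  then show ?thesis
    unfolding fock_norm_eq * by (simp add: integral_eq_nn_integral fock_integrand_nonneg)
qed

text \<open>Under a rotation the images of the normalized kernels at \<open>n \<rightarrow> \<infinity>\<close> keep their norm but tend to
  zero pointwise.\<close>

lemma rotation_not_compact:
  assumes p: "p \<ge> 1" and a: "cmod a = 1"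
  shows "\<not> compact_op (fock_space p) (fock_norm p) (comp_op (\<lambda>z. a * z))"
proof
  assume comp: "compact_op (fock_space p) (fock_norm p) (comp_op (\<lambda>z. a * z))"
  interpret F: function_space_norm "fock_space p" "fock_norm p"
    by (rule function_space_norm_fock[OF p])
  let ?T = "comp_op (\<lambda>z. a * z)"
  have T: "bounded_op (fock_space p) (fock_norm p) ?T" using comp by (simp add: compact_op_def)
  define N1 where "N1 = fock_norm p (\<lambda>z. 1)"
  have N1: "N1 > 0" unfolding N1_def by (rule fock_one(2)[OF p])
  define f where "f = (\<lambda>n z. of_real (1 / N1) * fock_shift (- of_nat n) (\<lambda>z. 1) z)"
  have f: "f n \<in> fock_space p" for n
    unfolding f_def by (intro fock_space_scale fock_shift fock_one p)
  have Nf: "fock_norm p (f n) = 1" for n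
    unfolding f_def fock_norm_scale[OF p] fock_shift(2)[OF fock_one(1)[OF p]]
    using N1 by (simp add: N1_def[symmetric] norm_divide)
  obtain g r where g: "g \<in> fock_space p" and r: "strict_mono r"
    and lim: "(\<lambda>n. fock_norm p (\<lambda>z. ?T (f (r n)) z - g z)) \<longlonglongrightarrow> 0"
    by (rule F.compact_op_subsequence[OF comp f eq_refl[OF Nf]])
  have Tf: "?T (f n) \<in> fock_space p" for n using T f by (simp add: bounded_op_def)
  obtain C where C: "C > 0"
    "\<And>f z. f \<in> fock_space p \<Longrightarrow> cmod (f z) \<le> C * fock_norm p f * exp ((cmod z)\<^sup>2 / 2)"
    using fock_evaluation[OF p] by blast
  \<comment> \<open>Point evaluation turns norm convergence into pointwise convergence, so
    \<open>g\<close> is the pointwise limit; the factor exp(-n^2/2) in the kernels makes it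
    0.\<close>
  have "g z = 0" for z
  proof -
    have "(\<lambda>n. C * fock_norm p (\<lambda>z. ?T (f (r n)) z - g z) * exp ((cmod z)\<^sup>2 / 2)) \<longlonglongrightarrow> 0"
      by (rule tendsto_eq_intros lim refl | simp)+
    then have "(\<lambda>n. ?T (f (r n)) z - g z) \<longlonglongrightarrow> 0"
      by (rule Lim_null_comparison[rotated]) (intro always_eventually allI C(2) F.diff_mem Tf g)
    moreover have "(\<lambda>n. ?T (f (r n)) z) \<longlonglongrightarrow> 0"
    proof -
      have Re_nat: "Re (of_nat n * w) = real n * Re w" for n w by simp
      have eq: "cmod (?T (f n) z) = 1 / N1 * exp (real n * Re (a * z) - (real n)\<^sup>2 / 2)" for n
        using N1 by (simp add: f_def comp_op_def fock_shift_def norm_mult norm_divide norm_exp_eq_Re Re_nat del: times_complex.sel)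
      have "(\<lambda>n. exp (real n * x - (real n)\<^sup>2 / 2)) \<longlonglongrightarrow> 0" for x :: real
        by real_asymp
      then have "(\<lambda>n. cmod (?T (f n) z)) \<longlonglongrightarrow> 0"
        unfolding eq by (rule tendsto_mult_right_zero)
      then have "(\<lambda>n. ?T (f n) z) \<longlonglongrightarrow> 0" by (rule tendsto_norm_zero_cancel)
      from LIMSEQ_subseq_LIMSEQ[OF this r] show ?thesis by (simp add: o_def)
    qed
    ultimately have "(\<lambda>n. ?T (f (r n)) z - (?T (f (r n)) z - g z)) \<longlonglongrightarrow> 0 - 0"
      by (intro tendsto_diff)
    then show "g z = 0" by (simp add: LIMSEQ_const_iff)
  qed
  moreover have "fock_norm p (?T (f n)) = 1" for n
    using fock_norm_rotate[OF f a, of n] Nf by (simp add: comp_op_def o_def)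
  \<comment> \<open>With \<open>g = 0\<close> the distances tending to 0 are the norms themselves,
    all equal to 1.\<close>
  ultimately have "(\<lambda>n::nat. 1::real) \<longlonglongrightarrow> 0" using lim by simp
  then show False by (simp add: LIMSEQ_const_iff)
qed

section \<open>Contractive symbols\<close>

text \<open>Cauchy's estimate on a circle of radius 1. Passing from |z| to |z| + 1 adds only linear
  terms to the exponent, which a contraction can absorb.\<close>

lemma fock_deriv_bound:
  assumes p: "p \<ge> 1"
    and C: "C > 0" "\<And>f z. f \<in> fock_space p \<Longrightarrow> cmod (f z) \<le> C * fock_norm p f * exp ((cmod z)\<^sup>2 / 2)"
    and f: "f \<in> fock_space p"
  shows "cmod (deriv f z) \<le> C * fock_norm p f * exp ((cmod z + 1)\<^sup>2 / 2)"
proof -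
  have hol: "f holomorphic_on UNIV" using f by (simp add: fock_space_iff)
  have "cmod ((deriv ^^ 1) f z) \<le> fact 1 * (C * fock_norm p f * exp ((cmod z + 1)\<^sup>2 / 2)) / 1 ^ 1"
  proof (rule Cauchy_inequality)
    show "f holomorphic_on ball z 1" "continuous_on (cball z 1) f"
      using hol by (auto intro: holomorphic_on_subset holomorphic_on_imp_continuous_on)
    fix x assume "cmod (z - x) = 1"
    then have "cmod x \<le> cmod z + 1"
      using norm_triangle_ineq2[of x z] by (simp add: norm_minus_commute)
    then have "exp ((cmod x)\<^sup>2 / 2) \<le> exp ((cmod z + 1)\<^sup>2 / 2)"
      by (simp add: power_mono)
    then have "C * fock_norm p f * exp ((cmod x)\<^sup>2 / 2) \<le> C * fock_norm p f * exp ((cmod z + 1)\<^sup>2 / 2)"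
      using C(1) fock_norm_nonneg by (intro mult_left_mono) auto
    then show "cmod (f x) \<le> C * fock_norm p f * exp ((cmod z + 1)\<^sup>2 / 2)"
      using C(2)[OF f, of x] by linarith
  qed simp
  then show ?thesis by simp
qed

locale contractive_symbol =
  fixes p :: real and a b :: complex
  assumes p: "p \<ge> 1" and a: "cmod a < 1"
    and T: "bounded_op (fock_space p) (fock_norm p) (comp_op (\<lambda>z. a * z + b))"
begin

sublocale F: function_space_norm "fock_space p" "fock_norm p"
  by (rule function_space_norm_fock[OF p])

definition z0 :: complex where "z0 = b / (1 - a)"

abbreviation T where "T \<equiv> comp_op (\<lambda>z. a * z + b)"

lemma symbol_eq: "a * z + b = z0 + a * (z - z0)"
proof -
  have "(1 - a) * z0 = b" using a by (auto simp: z0_def)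
  then show ?thesis by (simp add: algebra_simps)
qed

lemma funpow_T: "(T ^^ n) f z = f (z0 + a ^ n * (z - z0))"
proof (induction n arbitrary: z)
  case (Suc n)
  have "(T ^^ Suc n) f z = (T ^^ n) f (a * z + b)" by (simp add: comp_op_def)
  also have "\<dots> = f (z0 + a ^ n * (a * z + b - z0))" by (rule Suc)
  finally show ?case by (simp add: symbol_eq mult_ac)
qed simp

text \<open>The exponent starts at \<open>Suc 0\<close> on purpose: for the zeroth iterate the
  normalized kernels rule out any uniform bound with \<open>q < 1\<close>.\<close>

definition iterate_bound :: "real \<Rightarrow> real \<Rightarrow> bool" where
  "iterate_bound q A \<longleftrightarrow> q < 1 \<and> A > 0 \<and>
    (\<forall>f\<in>fock_space p. \<forall>n z.
      cmod (f (z0 + a ^ Suc n * (z - z0)) - f z0) \<le> A * fock_norm p f * cmod a ^ Suc n * exp (q * (cmod z)\<^sup>2 / 2))"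

text \<open>All iterates from the first on stay in the disc of radius |a| |z - z0| about z0. The
  derivative bound on that disc carries the Gaussian gap, and the displacement from z0 supplies the
  factor |a|^(n+1).\<close>

lemma iterate_bound: "\<exists>q A. iterate_bound q A"
proof -
  obtain C where C: "C > 0"
    "\<And>f z. f \<in> fock_space p \<Longrightarrow> cmod (f z) \<le> C * fock_norm p f * exp ((cmod z)\<^sup>2 / 2)"
    using fock_evaluation[OF p] by blast
  \<comment> \<open>The point is |z0| + \<rho> + 1 <= |a| |z| + 2 |z0| + 1, and |z - z0| <= |z| +
    |z0|.\<close>
  obtain q A where q: "q < 1" and A: "A > 0"
    and absorb: "\<And>r t. 0 \<le> r \<Longrightarrow> 0 \<le> t \<Longrightarrow> r \<le> cmod a * t + (2 * cmod z0 + 1)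
        \<Longrightarrow> exp (r\<^sup>2 / 2) * (t + cmod z0) \<le> A * exp (q * t\<^sup>2 / 2)"
    using gaussian_absorbs_linear[of "cmod a" "2 * cmod z0 + 1" "cmod z0"] a by auto
  have "cmod (f (z0 + a ^ Suc n * (z - z0)) - f z0)
      \<le> C * A * fock_norm p f * cmod a ^ Suc n * exp (q * (cmod z)\<^sup>2 / 2)"
    if f: "f \<in> fock_space p" for f n z
  proof -
    define \<rho> where "\<rho> = cmod a * cmod (z - z0)"
    have \<rho>: "\<rho> \<ge> 0" by (simp add: \<rho>_def)
    define B where "B = C * fock_norm p f * exp ((cmod z0 + \<rho> + 1)\<^sup>2 / 2)"
    have hol: "f holomorphic_on UNIV" using f by (simp add: fock_space_iff)
    have "cmod (f (z0 + a ^ Suc n * (z - z0)) - f z0) \<le> B * cmod (z0 + a ^ Suc n * (z - z0) - z0)"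
    proof (rule field_differentiable_bound[of "cball z0 \<rho>"])
      show "(f has_field_derivative deriv f w) (at w within cball z0 \<rho>)" if "w \<in> cball z0 \<rho>" for w
        using holomorphic_derivI[OF hol open_UNIV UNIV_I] by (rule has_field_derivative_at_within)
      show "cmod (deriv f w) \<le> B" if "w \<in> cball z0 \<rho>" for w
      proof -
        have "cmod w \<le> cmod z0 + \<rho>"
          using that norm_triangle_ineq2[of w z0] by (simp add: dist_norm norm_minus_commute)
        then have "exp ((cmod w + 1)\<^sup>2 / 2) \<le> exp ((cmod z0 + \<rho> + 1)\<^sup>2 / 2)"
          by (simp add: power_mono)
        then have "C * fock_norm p f * exp ((cmod w + 1)\<^sup>2 / 2) \<le> B"
          unfolding B_def using C(1) fock_norm_nonneg by (intro mult_left_mono) auto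
        then show ?thesis using fock_deriv_bound[OF p C f, of w] by linarith
      qed
      have "cmod a ^ Suc n \<le> cmod a ^ 1"
        using a by (intro power_decreasing) auto
      then have "cmod a ^ Suc n * cmod (z - z0) \<le> \<rho>"
        unfolding \<rho>_def by (intro mult_right_mono) auto
      then show "z0 + a ^ Suc n * (z - z0) \<in> cball z0 \<rho>"
        by (simp only: mem_cball dist_norm) (simp add: norm_mult norm_power)
    qed (use \<rho> in auto)
    also have "\<dots> = (C * fock_norm p f * cmod a ^ Suc n) * (exp ((cmod z0 + \<rho> + 1)\<^sup>2 / 2) * cmod (z - z0))"
      by (simp add: B_def norm_mult norm_power mult_ac)
    also have "exp ((cmod z0 + \<rho> + 1)\<^sup>2 / 2) * cmod (z - z0) \<le> A * exp (q * (cmod z)\<^sup>2 / 2)"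
    proof -
      have tri: "cmod (z - z0) \<le> cmod z + cmod z0" by (rule norm_triangle_ineq4)
      have "\<rho> \<le> cmod a * (cmod z + cmod z0)"
        unfolding \<rho>_def using tri by (intro mult_left_mono) auto
      also have "\<dots> \<le> cmod a * cmod z + cmod z0"
        using a mult_right_mono[of "cmod a" 1 "cmod z0"] by (simp add: distrib_left)
      finally have "exp ((cmod z0 + \<rho> + 1)\<^sup>2 / 2) * (cmod z + cmod z0) \<le> A * exp (q * (cmod z)\<^sup>2 / 2)"
        using \<rho> by (intro absorb) auto
      moreover have "exp ((cmod z0 + \<rho> + 1)\<^sup>2 / 2) * cmod (z - z0)
          \<le> exp ((cmod z0 + \<rho> + 1)\<^sup>2 / 2) * (cmod z + cmod z0)"
        using tri by (intro mult_left_mono) auto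
      ultimately show ?thesis by linarith
    qed
    then have "(C * fock_norm p f * cmod a ^ Suc n) * (exp ((cmod z0 + \<rho> + 1)\<^sup>2 / 2) * cmod (z - z0))
       \<le> (C * fock_norm p f * cmod a ^ Suc n) * (A * exp (q * (cmod z)\<^sup>2 / 2))"
      using C(1) fock_norm_nonneg by (intro mult_left_mono) auto
    finally show ?thesis by (simp add: mult_ac)
  qed
  then have "iterate_bound q (C * A)"
    unfolding iterate_bound_def using q A C(1) by auto
  then show ?thesis by blast
qed

lemma unconditional_ritt: "unconditional_ritt_condition (fock_space p) (fock_norm p) T"
proof -
  obtain q A where "iterate_bound q A" using iterate_bound by blast
  then have q: "q < 1" and A: "A > 0" and bound: "\<And>f n z. f \<in> fock_space p \<Longrightarrow>
      cmod (f (z0 + a ^ Suc n * (z - z0)) - f z0) \<le> A * fock_norm p f * cmod a ^ Suc n * exp (q * (cmod z)\<^sup>2 / 2)"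
    unfolding iterate_bound_def by blast+
  obtain D where D: "0 \<le> D" "\<And>f. f \<in> fock_space p \<Longrightarrow> fock_norm p (T f) \<le> D * fock_norm p f"
    using F.bounded_op_nonneg_bound[OF T] by blast
  define G where "G = fock_gauss_norm p q"
  have G: "G \<ge> 0" by (simp add: G_def fock_gauss_norm_def fock_norm_nonneg)
  \<comment> \<open>For n >= 1 two consecutive iterates are both compared with f(z0), which costs 2
    A G; the difference T - I has no Gaussian majorant and costs D + 1.\<close>
  define K where "K = 2 * A * G + D + 1"
  have K: "K \<ge> 0" using A G D(1) by (simp add: K_def)
  show ?thesis
  proof (rule F.unconditional_ritt_of_summable[OF T, of "\<lambda>n. K * cmod a ^ n"])
    show "summable (\<lambda>n. K * cmod a ^ n)"
      using a by (intro summable_mult summable_geometric) simp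
    show "0 \<le> K * cmod a ^ n" for n using K by simp
    fix n f assume f: "f \<in> fock_space p"
    have mem: "(T ^^ n) f \<in> fock_space p" for n
      using F.bounded_op_funpow[OF T] f by (simp add: bounded_op_def)
    show "fock_norm p (\<lambda>x. (T ^^ Suc n) f x - (T ^^ n) f x) \<le> K * cmod a ^ n * fock_norm p f"
    proof (cases n)
      case 0
      have "fock_norm p (\<lambda>x. T f x - f x) \<le> fock_norm p (T f) + fock_norm p f"
        using mem[of 1] f by (intro F.norm_diff_triangle) simp_all
      also have "\<dots> \<le> (D + 1) * fock_norm p f" using D(2)[OF f] by (simp add: distrib_right)
      also have "\<dots> \<le> K * fock_norm p f"
        using A G by (intro mult_right_mono fock_norm_nonneg) (simp add: K_def)
      finally show ?thesis by (simp add: 0)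
    next
      case (Suc m)
      let ?E = "\<lambda>z. exp (q * (cmod z)\<^sup>2 / 2)"
      have "fock_norm p (\<lambda>x. (T ^^ Suc n) f x - (T ^^ n) f x) \<le> (2 * A * fock_norm p f * cmod a ^ n) * G"
        unfolding G_def
      proof (rule fock_space_of_gaussian_bound(2)[OF p q])
        show "(\<lambda>x. (T ^^ Suc n) f x - (T ^^ n) f x) holomorphic_on UNIV"
          using F.diff_mem[OF mem[of "Suc n"] mem[of n]] unfolding fock_space_iff by blast
        show "0 \<le> 2 * A * fock_norm p f * cmod a ^ n" using A fock_norm_nonneg by simp
        fix z
        have le1: "cmod (f (z0 + a ^ Suc n * (z - z0)) - f z0) \<le> A * fock_norm p f * cmod a ^ n * ?E z"
        proof -
          have "cmod a ^ Suc n \<le> cmod a ^ n" using a by (intro power_decreasing) auto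
          then have "A * fock_norm p f * cmod a ^ Suc n * ?E z \<le> A * fock_norm p f * cmod a ^ n * ?E z"
            using A fock_norm_nonneg by (intro mult_left_mono mult_right_mono) auto
          then show ?thesis using bound[OF f, of n z] by linarith
        qed
        have le2: "cmod (f (z0 + a ^ n * (z - z0)) - f z0) \<le> A * fock_norm p f * cmod a ^ n * ?E z"
          unfolding Suc by (rule bound[OF f])
        have "cmod ((T ^^ Suc n) f z - (T ^^ n) f z)
            \<le> cmod (f (z0 + a ^ Suc n * (z - z0)) - f z0) + cmod (f (z0 + a ^ n * (z - z0)) - f z0)"
          unfolding funpow_T by (metis norm_triangle_ineq4 diff_diff_eq2 diff_add_cancel)
        then show "cmod ((T ^^ Suc n) f z - (T ^^ n) f z) \<le> 2 * A * fock_norm p f * cmod a ^ n * ?E z"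
          using le1 le2 by linarith
      qed
      also have "\<dots> = (2 * A * G) * (cmod a ^ n * fock_norm p f)" by (simp add: mult_ac)
      also have "\<dots> \<le> K * (cmod a ^ n * fock_norm p f)"
        using D(1) fock_norm_nonneg by (intro mult_right_mono) (auto simp: K_def)
      finally show ?thesis by (simp add: mult_ac)
    qed
  qed
qed

lemma ritt_resolvent: "ritt_resolvent_condition (fock_space p) (fock_norm p) T"
proof -
  obtain q A where "iterate_bound q A" using iterate_bound by blast
  then have q: "q < 1" and A: "A > 0" and bound: "\<And>f n z. f \<in> fock_space p \<Longrightarrow>
      cmod (f (z0 + a ^ Suc n * (z - z0)) - f z0) \<le> A * fock_norm p f * cmod a ^ Suc n * exp (q * (cmod z)\<^sup>2 / 2)"
    unfolding iterate_bound_def by blast+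
  obtain C where C: "C > 0"
    "\<And>f z. f \<in> fock_space p \<Longrightarrow> cmod (f z) \<le> C * fock_norm p f * exp ((cmod z)\<^sup>2 / 2)"
    using fock_evaluation[OF p] by blast
  define G where "G = fock_gauss_norm p q"
  have G: "G \<ge> 0" by (simp add: G_def fock_gauss_norm_def fock_norm_nonneg)
  \<comment> \<open>A bound for the rank-one operator sending \<open>f\<close> to the constant
    f(z0).\<close>
  define E where "E = C * exp ((cmod z0)\<^sup>2 / 2) * fock_norm p (\<lambda>z. 1)"
  have E: "E \<ge> 0" using C(1) by (simp add: E_def fock_norm_nonneg)
  define B where "B = A * G / (1 - cmod a)"
  have B: "B \<ge> 0" using A G a by (simp add: B_def)
  \<comment> \<open>The first \<open>E\<close> belongs to the term over l - 1. The remainder has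
    size (1 + E + B)/|l|, and its constant doubles because |l - 1| <= 2 |l|.\<close>
  define M where "M = E + 2 * (1 + E) + 2 * B"
  have M: "M > 0" using E B by (simp add: M_def)
  \<comment> \<open>The term k = n + 1 of the series of T^k f / l^(k+1), with the fixed point value
    subtracted. The term k = 0 lacks the Gaussian gap and enters \<open>R\<close> directly.\<close>
  define h where "h = (\<lambda>(l::complex) (f::complex \<Rightarrow> complex) n z. (f (z0 + a ^ Suc n * (z - z0)) - f z0) / l ^ Suc (Suc n))"
  define H where "H = (\<lambda>l f z. \<Sum>n. h l f n z)"
  have h_bound: "cmod (h l f n z) \<le> A * fock_norm p f * exp (q * (cmod z)\<^sup>2 / 2) / cmod l * cmod a ^ n"
    if l: "cmod l > 1" and f: "f \<in> fock_space p" for l f n z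
  proof -
    let ?X = "A * fock_norm p f * exp (q * (cmod z)\<^sup>2 / 2)"
    have X: "?X \<ge> 0" using A fock_norm_nonneg by simp
    have "cmod (h l f n z) = cmod (f (z0 + a ^ Suc n * (z - z0)) - f z0) / cmod l ^ Suc (Suc n)"
      by (simp only: h_def norm_divide norm_power)
    also have "\<dots> \<le> (?X * cmod a ^ Suc n) / cmod l ^ Suc (Suc n)"
      using bound[OF f, of n z] by (intro divide_right_mono) (simp_all add: mult_ac)
    also have "\<dots> \<le> (?X * cmod a ^ n) / cmod l"
    proof (rule frac_le)
      show "?X * cmod a ^ Suc n \<le> ?X * cmod a ^ n"
        using X a by (intro mult_left_mono power_decreasing) auto
      show "cmod l \<le> cmod l ^ Suc (Suc n)"
        using l power_increasing[of 1 "Suc (Suc n)" "cmod l"] by simp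
    qed (use X l in auto)
    finally show ?thesis by simp
  qed
  have geometric: "summable (\<lambda>n. c * cmod a ^ n)" "(\<Sum>n. c * cmod a ^ n) = c / (1 - cmod a)" for c
    using a by (auto simp: summable_geometric summable_mult suminf_mult suminf_geometric)
  have h_summable: "summable (\<lambda>n. h l f n z)" if "cmod l > 1" "f \<in> fock_space p" for l f z
    by (rule summable_comparison_test'[OF geometric(1) h_bound[OF that]])
  have H_bound: "cmod (H l f z) \<le> (A * fock_norm p f / (cmod l * (1 - cmod a))) * exp (q * (cmod z)\<^sup>2 / 2)"
    if "cmod l > 1" "f \<in> fock_space p" for l f z
  proof -
    have "summable (\<lambda>n. cmod (h l f n z))"
      by (rule summable_comparison_test'[OF geometric(1), of 0]) (use h_bound[OF that] in \<open>simp only: real_norm_def abs_norm_cancel\<close>)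
    then have "cmod (H l f z) \<le> (\<Sum>n. cmod (h l f n z))"
      unfolding H_def by (rule summable_norm)
    also have "\<dots> \<le> (\<Sum>n. A * fock_norm p f * exp (q * (cmod z)\<^sup>2 / 2) / cmod l * cmod a ^ n)"
      using \<open>summable (\<lambda>n. cmod (h l f n z))\<close> by (intro suminf_le geometric h_bound that)
    finally show ?thesis unfolding geometric by (simp add: mult_ac)
  qed
  have h_hol: "h l f n holomorphic_on UNIV" if f: "f \<in> fock_space p" for l f n
  proof -
    have "(f \<circ> (\<lambda>z. z0 + a ^ Suc n * (z - z0))) holomorphic_on UNIV"
      using f by (intro holomorphic_on_compose_gen[of _ UNIV f UNIV] holomorphic_intros) (auto simp: fock_space_iff)
    then have "(\<lambda>z. (1 / l ^ Suc (Suc n)) * ((f \<circ> (\<lambda>z. z0 + a ^ Suc n * (z - z0))) z - f z0)) holomorphic_on UNIV"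
      by (intro holomorphic_intros)
    then show ?thesis by (simp add: h_def [abs_def] o_def)
  qed
  have H_hol: "H l f holomorphic_on UNIV" if l: "cmod l > 1" and f: "f \<in> fock_space p" for l f
  proof (rule holomorphic_uniform_sequence[OF open_UNIV])
    show "(\<lambda>z. \<Sum>n<N. h l f n z) holomorphic_on UNIV" for N
      by (intro holomorphic_on_sum h_hol f)
    fix x :: complex
    define R where "R = cmod x + 1"
    have "uniform_limit (cball x 1) (\<lambda>N z. \<Sum>n<N. h l f n z) (\<lambda>z. \<Sum>n. h l f n z) sequentially"
    proof (rule Weierstrass_m_test)
      fix n z assume "z \<in> cball x 1"
      then have "cmod z \<le> R" using norm_triangle_ineq2[of z x] by (simp add: R_def dist_norm norm_minus_commute)
      \<comment> \<open>Only \<open>q < 1\<close> is known; the absolute value keeps the bound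
        monotone in |z| if \<open>q\<close> is negative.\<close>
      have "q * (cmod z)\<^sup>2 / 2 \<le> \<bar>q\<bar> * R\<^sup>2 / 2"
        using \<open>cmod z \<le> R\<close> by (intro divide_right_mono mult_mono power_mono) auto
      then have "A * fock_norm p f * exp (q * (cmod z)\<^sup>2 / 2) / cmod l * cmod a ^ n
          \<le> A * fock_norm p f * exp (\<bar>q\<bar> * R\<^sup>2 / 2) / cmod l * cmod a ^ n"
        using A fock_norm_nonneg by (intro mult_right_mono divide_right_mono mult_left_mono) auto
      then show "cmod (h l f n z) \<le> A * fock_norm p f * exp (\<bar>q\<bar> * R\<^sup>2 / 2) / cmod l * cmod a ^ n"
        using h_bound[OF l f, of n z] by linarith
    qed (rule geometric)
    then show "\<exists>d>0. cball x d \<subseteq> UNIV \<and> uniform_limit (cball x d) (\<lambda>N z. \<Sum>n<N. h l f n z) (H l f) sequentially"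
      unfolding H_def by (intro exI[of _ 1]) simp
  qed
  have H_mem: "H l f \<in> fock_space p" and H_norm: "fock_norm p (H l f) \<le> B / cmod l * fock_norm p f"
    if l: "cmod l > 1" and f: "f \<in> fock_space p" for l f
  proof -
    have nn: "0 \<le> A * fock_norm p f / (cmod l * (1 - cmod a))"
      using A a fock_norm_nonneg by simp
    note * = fock_space_of_gaussian_bound[OF p q H_hol[OF that] nn H_bound[OF that]]
    show "H l f \<in> fock_space p" by (rule *(1))
    show "fock_norm p (H l f) \<le> B / cmod l * fock_norm p f"
      using *(2) by (simp add: B_def G_def mult_ac)
  qed
  \<comment> \<open>The Neumann series of \<open>T\<close>, with the values at the fixed point summed separately.\<close>
  define R where "R = (\<lambda>l f z. (f z0 / (l - 1)) * 1 + ((1 / l) * (f z + (- f z0) * 1) + H l f z))"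
  note one = fock_one(1)[OF p]
  show ?thesis
  proof (rule F.ritt_resolvent_of_right_inverse[OF T M, of R])
    fix l f assume l: "cmod l > 1" and f: "f \<in> fock_space p"
    have l0: "l \<noteq> 0" "l - 1 \<noteq> 0" "cmod (l - 1) > 0" using l by auto
    show "R l f \<in> fock_space p"
      unfolding R_def by (intro F.add_mem F.scale_mem one f H_mem l)
    show "(\<lambda>z. l * R l f z - T (R l f) z) = f"
    proof
      fix z
      \<comment> \<open>Applying \<open>T\<close> to term n gives \<open>l\<close> times term n + 1,
        so l H - T H collapses to the first term of the series.\<close>
      have tail: "h l f (Suc n) z * l = h l f n (a * z + b)" for n
        using l0 by (simp add: h_def symbol_eq mult_ac)
      have "l * H l f z = (\<Sum>n. h l f n z * l)"
        unfolding H_def by (subst mult.commute) (rule suminf_mult2[OF h_summable[OF l f]])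
      also have "\<dots> = h l f 0 z * l + (\<Sum>n. h l f (Suc n) z * l)"
        using suminf_split_head[OF summable_mult2[OF h_summable[OF l f, of z], of l]] by simp
      also have "\<dots> = (f (a * z + b) - f z0) / l + H l f (a * z + b)"
        unfolding tail H_def using l0 by (simp add: h_def symbol_eq)
      finally have HT: "l * H l f z = (f (a * z + b) - f z0) / l + H l f (a * z + b)" .
      have "l * R l f z - T (R l f) z
          = (l - 1) * (f z0 / (l - 1)) + (l * (1 / l)) * (f z - f z0)
            + (l * H l f z - (f (a * z + b) - f z0) / l - H l f (a * z + b))"
        by (simp add: R_def comp_op_def algebra_simps diff_divide_distrib)
      also have "\<dots> = f z" unfolding HT using l0 by simp
      finally show "l * R l f z - T (R l f) z = f z" .
    qed
    have ev: "cmod (f z0) * fock_norm p (\<lambda>z. 1) \<le> E * fock_norm p f"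
      using mult_right_mono[OF C(2)[OF f, of z0] fock_norm_nonneg[of p "\<lambda>z. 1"]] by (simp add: E_def mult_ac)
    have "fock_norm p (R l f) \<le> fock_norm p (\<lambda>z. (f z0 / (l - 1)) * 1)
        + (fock_norm p (\<lambda>z. (1 / l) * (f z + (- f z0) * 1)) + fock_norm p (H l f))"
      unfolding R_def
      by (intro order_trans[OF F.norm_triangle] add_left_mono F.norm_triangle F.add_mem F.scale_mem one f H_mem l)
    also have "\<dots> \<le> E * fock_norm p f / cmod (l - 1) + ((1 + E) * fock_norm p f / cmod l + B * fock_norm p f / cmod l)"
    proof (intro add_mono)
      show "fock_norm p (\<lambda>z. (f z0 / (l - 1)) * 1) \<le> E * fock_norm p f / cmod (l - 1)"
        unfolding F.norm_scale using divide_right_mono[OF ev, of "cmod (l - 1)"] by (simp add: norm_divide)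
      have "fock_norm p (\<lambda>z. f z + (- f z0) * 1) \<le> fock_norm p f + fock_norm p (\<lambda>z. (- f z0) * 1)"
        by (intro F.norm_triangle F.scale_mem one f)
      also have "\<dots> \<le> (1 + E) * fock_norm p f"
        unfolding F.norm_scale using ev by (simp add: distrib_right)
      finally show "fock_norm p (\<lambda>z. (1 / l) * (f z + (- f z0) * 1)) \<le> (1 + E) * fock_norm p f / cmod l"
        unfolding F.norm_scale using l by (simp add: norm_divide divide_right_mono)
      show "fock_norm p (H l f) \<le> B * fock_norm p f / cmod l"
        using H_norm[OF l f] by simp
    qed
    also have "\<dots> \<le> M / cmod (l - 1) * fock_norm p f"
    proof -
      have "cmod (l - 1) \<le> 2 * cmod l"
        using norm_triangle_ineq4[of l 1] l by simp
      then have inv: "1 / cmod l \<le> 2 / cmod (l - 1)"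
        using l l0 by (simp add: field_simps)
      have "(1 + E + B) * fock_norm p f * (1 / cmod l) \<le> (1 + E + B) * fock_norm p f * (2 / cmod (l - 1))"
        using E B fock_norm_nonneg by (intro mult_left_mono[OF inv]) auto
      moreover have "M / cmod (l - 1) * fock_norm p f
          = E * fock_norm p f / cmod (l - 1) + (1 + E + B) * fock_norm p f * (2 / cmod (l - 1))"
        using l0(3) by (simp add: M_def field_simps)
      moreover have "(1 + E) * fock_norm p f / cmod l + B * fock_norm p f / cmod l
          = (1 + E + B) * fock_norm p f * (1 / cmod l)"
        using l0(1) by (simp add: field_simps)
      ultimately show ?thesis by linarith
    qed
    finally show "fock_norm p (R l f) \<le> M / cmod (l - 1) * fock_norm p f" .
    assume eig: "T f = (\<lambda>z. l * f z)"
    show "f = (\<lambda>z. 0)"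
    proof
      fix z
      \<comment> \<open>For an eigenvector, l^(n+1) f(z) is the value of \<open>f\<close> at the
        iterate n + 1 of z, which stays bounded as the iterates approach z0; |l| > 1 then forces
        f(z) = 0.\<close>
      have "cmod (f z) * cmod l ^ Suc n \<le> cmod (f z0) + A * fock_norm p f * exp (q * (cmod z)\<^sup>2 / 2)" for n
      proof -
        have "cmod (f z) * cmod l ^ Suc n = cmod ((T ^^ Suc n) f z)"
          unfolding F.funpow_eigenvector[OF T f eig] by (simp add: norm_mult norm_power mult_ac)
        also have "\<dots> = cmod (f (z0 + a ^ Suc n * (z - z0)))" by (simp only: funpow_T)
        also have "\<dots> \<le> cmod (f z0) + cmod (f (z0 + a ^ Suc n * (z - z0)) - f z0)"
          using norm_triangle_ineq[of "f z0" "f (z0 + a ^ Suc n * (z - z0)) - f z0"] by simp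
        also have "\<dots> \<le> cmod (f z0) + A * fock_norm p f * cmod a ^ Suc n * exp (q * (cmod z)\<^sup>2 / 2)"
          using bound[OF f] by (intro add_left_mono)
        also have "\<dots> \<le> cmod (f z0) + A * fock_norm p f * 1 * exp (q * (cmod z)\<^sup>2 / 2)"
          using a A fock_norm_nonneg
          by (intro add_left_mono mult_right_mono mult_left_mono power_le_one) auto
        finally show ?thesis by simp
      qed
      note * = this
      show "f z = 0"
      proof (rule ccontr)
        assume "f z \<noteq> 0"
        then have pos: "cmod (f z) > 0" by simp
        obtain n where n: "(cmod (f z0) + A * fock_norm p f * exp (q * (cmod z)\<^sup>2 / 2)) / cmod (f z) < cmod l ^ n"
          using real_arch_pow[OF l] by blast
        also have "\<dots> \<le> cmod l ^ Suc n" using l by (intro power_increasing) auto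
        finally show False using *[of n] pos by (simp add: divide_less_eq mult_ac)
      qed
    qed
  qed
qed

text \<open>Montel's theorem gives locally uniform limits of bounded sequences; composition with the symbol
  creates a Gaussian gap that dominates their Fock integrands.\<close>

lemma compact: "compact_op (fock_space p) (fock_norm p) T"
proof (rule F.compact_op_of_subsequences[OF T])
  fix f :: "nat \<Rightarrow> complex \<Rightarrow> complex"
  assume f: "\<And>n. f n \<in> fock_space p \<and> fock_norm p (f n) \<le> 1"
  obtain C where C: "C > 0"
    "\<And>f z. f \<in> fock_space p \<Longrightarrow> cmod (f z) \<le> C * fock_norm p f * exp ((cmod z)\<^sup>2 / 2)"
    using fock_evaluation[OF p] by blast
  have unit: "cmod (g z) \<le> C * exp ((cmod z)\<^sup>2 / 2)" if "g \<in> fock_space p" "fock_norm p g \<le> 1" for g z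
  proof -
    have "C * fock_norm p g * exp ((cmod z)\<^sup>2 / 2) \<le> C * 1 * exp ((cmod z)\<^sup>2 / 2)"
      using C(1) that by (intro mult_left_mono mult_right_mono) auto
    then show ?thesis using C(2)[OF that(1), of z] by simp
  qed
  define \<H> where "\<H> = {g \<in> fock_space p. fock_norm p g \<le> 1}"
  obtain g r where g: "g holomorphic_on UNIV" and r: "strict_mono (r :: nat \<Rightarrow> nat)"
    and lim: "\<And>z. (\<lambda>n. f (r n) z) \<longlonglongrightarrow> g z"
  proof (rule Montel[of UNIV \<H> f])
    show "\<exists>B. \<forall>h\<in>\<H>. \<forall>z\<in>K. cmod (h z) \<le> B" if K: "compact K" for K
    proof -
      obtain \<rho> where \<rho>: "\<And>z. z \<in> K \<Longrightarrow> cmod z \<le> \<rho>"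
        using compact_imp_bounded[OF K] by (auto simp: bounded_iff)
      have "cmod (h z) \<le> C * exp (\<rho>\<^sup>2 / 2)" if "h \<in> \<H>" "z \<in> K" for h z
      proof -
        have "exp ((cmod z)\<^sup>2 / 2) \<le> exp (\<rho>\<^sup>2 / 2)" using \<rho>[OF that(2)] by (simp add: power_mono)
        then have "C * exp ((cmod z)\<^sup>2 / 2) \<le> C * exp (\<rho>\<^sup>2 / 2)" using C(1) by simp
        then show ?thesis using unit[of h z] that(1) by (simp add: \<H>_def)
      qed
      then show ?thesis by blast
    qed
  qed (use f in \<open>auto simp: \<H>_def fock_space_iff\<close>)
  \<comment> \<open>The limit inherits only the borderline growth, so membership in the space is
    established for \<open>T g\<close>, not for \<open>g\<close>.\<close>
  have g_bound: "cmod (g z) \<le> C * exp ((cmod z)\<^sup>2 / 2)" for z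
    by (rule tendsto_upperbound[OF tendsto_norm[OF lim]]) (use f unit in auto)
  obtain q A where q: "q < 1" and A: "A > 0"
    and absorb: "\<And>r t. 0 \<le> r \<Longrightarrow> 0 \<le> t \<Longrightarrow> r \<le> cmod a * t + cmod b
        \<Longrightarrow> exp (r\<^sup>2 / 2) * (t + 1) \<le> A * exp (q * t\<^sup>2 / 2)"
    using gaussian_absorbs_linear[of "cmod a" "cmod b" 1] a by auto
  have gap: "exp ((cmod (a * z + b))\<^sup>2 / 2) \<le> A * exp (q * (cmod z)\<^sup>2 / 2)" for z
  proof -
    have "exp ((cmod (a * z + b))\<^sup>2 / 2) * 1 \<le> exp ((cmod (a * z + b))\<^sup>2 / 2) * (cmod z + 1)"
      by (intro mult_left_mono) auto
    also have "\<dots> \<le> A * exp (q * (cmod z)\<^sup>2 / 2)"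
      using norm_triangle_ineq[of "a * z" b] by (intro absorb) (auto simp: norm_mult)
    finally show ?thesis by simp
  qed
  have comp_bound: "cmod (T h z) \<le> (C * A) * exp (q * (cmod z)\<^sup>2 / 2)"
    if "\<And>z. cmod (h z) \<le> C * exp ((cmod z)\<^sup>2 / 2)" for h z
  proof -
    have "cmod (T h z) \<le> C * exp ((cmod (a * z + b))\<^sup>2 / 2)"
      using that[of "a * z + b"] by (simp add: comp_op_def)
    also have "\<dots> \<le> C * (A * exp (q * (cmod z)\<^sup>2 / 2))"
      using C(1) by (intro mult_left_mono gap) simp
    finally show ?thesis by (simp only: mult.assoc)
  qed
  have T_hol: "T h holomorphic_on UNIV" if "h holomorphic_on UNIV" for h
    unfolding comp_op_def
    by (intro holomorphic_on_compose_gen[of _ UNIV h UNIV] holomorphic_intros that) auto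
  have Tg: "T g \<in> fock_space p"
    using C(1) A by (intro fock_space_of_gaussian_bound(1)[OF p q T_hol[OF g] _ comp_bound[OF g_bound]]) auto
  have Tf: "T (f n) \<in> fock_space p" for n using T f by (simp add: bounded_op_def)
  let ?d = "\<lambda>n z. T (f (r n)) z - T g z"
  let ?w = "\<lambda>z. of_real (2 * (C * A)) * complex_of_real (exp (q * (cmod z)\<^sup>2 / 2))"
  have w: "integrable lborel (fock_integrand p ?w)"
    unfolding fock_integrand_scale[OF p, abs_def] by (intro integrable_mult_right fock_gaussian p q)
  have "(\<lambda>n. LINT z|lborel. fock_integrand p (?d n) z) \<longlonglongrightarrow> (LINT z|(lborel :: complex measure). 0)"
  proof (rule integral_dominated_convergence[OF _ _ w])
    have "?d n \<in> borel_measurable borel" for n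
      using F.diff_mem[OF Tf Tg] by (intro holomorphic_borel_measurable) (simp add: fock_space_iff)
    then show "fock_integrand p (?d n) \<in> borel_measurable lborel" for n
      by (simp add: borel_measurable_fock_integrand)
    show "AE z in lborel. (\<lambda>n. fock_integrand p (?d n) z) \<longlonglongrightarrow> 0"
    proof (rule always_eventually, rule allI)
      fix z
      have "(\<lambda>n. cmod (?d n z) * exp (- ((cmod z)\<^sup>2 / 2))) \<longlonglongrightarrow> cmod (g (a * z + b) - g (a * z + b)) * exp (- ((cmod z)\<^sup>2 / 2))"
        unfolding comp_op_def o_def by (intro tendsto_intros lim)
      then have "(\<lambda>n. cmod (?d n z) * exp (- ((cmod z)\<^sup>2 / 2))) \<longlonglongrightarrow> 0" by simp
      then show "(\<lambda>n. fock_integrand p (?d n) z) \<longlonglongrightarrow> 0"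
        unfolding fock_integrand_def using p
        by (intro tendsto_zero_powrI) (auto intro: tendsto_const)
    qed
    show "AE z in lborel. norm (fock_integrand p (?d n) z) \<le> fock_integrand p ?w z" for n
    proof (rule always_eventually, rule allI)
      fix z
      have "cmod (?d n z) \<le> cmod (T (f (r n)) z) + cmod (T g z)" by (rule norm_triangle_ineq4)
      also have "\<dots> \<le> cmod (?w z)"
        using comp_bound[of "f (r n)" z] comp_bound[OF g_bound, of z] f unit[of "f (r n)"] C(1) A
        by (simp add: norm_mult)
      finally show "norm (fock_integrand p (?d n) z) \<le> fock_integrand p ?w z"
        unfolding fock_integrand_def using p by (simp add: powr_mono2 mult_right_mono)
    qed
  qed simp
  then have "(\<lambda>n. p / (2 * pi) * (LINT z|lborel. fock_integrand p (?d n) z)) \<longlonglongrightarrow> 0"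
    by (intro tendsto_mult_right_zero) simp
  then have "(\<lambda>n. fock_norm p (?d n)) \<longlonglongrightarrow> 0"
    unfolding fock_norm_eq using p integral_fock_integrand_nonneg
    by (intro tendsto_zero_powrI) (auto intro: tendsto_const)
  with Tg r show "\<exists>g\<in>fock_space p. \<exists>r. strict_mono r \<and> (\<lambda>n. fock_norm p (\<lambda>x. T (f (r n)) x - g x)) \<longlonglongrightarrow> 0"
    by blast
qed

end

section \<open>The equivalence\<close>

theorem theorem3p4:
  fixes p :: real and \<psi> :: "complex \<Rightarrow> complex"
  assumes "1 \<le> p"
    and "\<psi> holomorphic_on UNIV"
    and "bounded_op (fock_space p) (fock_norm p) (comp_op \<psi>)"
  shows "(ritt_resolvent_condition (fock_space p) (fock_norm p) (comp_op \<psi>) \<longleftrightarrow>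
            compact_op (fock_space p) (fock_norm p) (comp_op \<psi>) \<or>
            (\<forall>f\<in>fock_space p. comp_op \<psi> f = f)) \<and>
         (compact_op (fock_space p) (fock_norm p) (comp_op \<psi>) \<or>
            (\<forall>f\<in>fock_space p. comp_op \<psi> f = f) \<longleftrightarrow>
          unconditional_ritt_condition (fock_space p) (fock_norm p) (comp_op \<psi>))"
proof -
  interpret F: function_space_norm "fock_space p" "fock_norm p"
    by (rule function_space_norm_fock[OF assms(1)])
  obtain K where K: "K \<ge> 0" "\<And>z. (cmod (\<psi> z))\<^sup>2 \<le> (cmod z)\<^sup>2 + K"
    using comp_op_symbol_growth[OF assms(1,3)] by blast
  obtain a b where \<psi>: "\<psi> = (\<lambda>z. a * z + b)"
    by (rule affine_of_growth[OF assms(2) K])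
  have a: "cmod a \<le> 1" and b: "cmod a = 1 \<Longrightarrow> b = 0"
    using affine_growth_coefficients[of K a b] K unfolding \<psi> by blast+
  have T: "bounded_op (fock_space p) (fock_norm p) (comp_op (\<lambda>z. a * z + b))"
    using assms(3) by (simp add: \<psi>)
  \<comment> \<open>In the first case compactness and both Ritt conditions hold; in the second the
    operator is the identity, which satisfies both Ritt conditions; in the third compactness,
    identity and both Ritt conditions all fail.\<close>
  consider "cmod a < 1" | "a = 1" "b = 0" | "cmod a = 1" "a \<noteq> 1" "b = 0"
    using a b by fastforce
  then show ?thesis
  proof cases
    case 1
    interpret contractive_symbol p a b
      using assms(1) 1 T by unfold_locales
    show ?thesis
      using compact ritt_resolvent unconditional_ritt unfolding \<psi> by blast
  next
    case 2
    then have id: "comp_op \<psi> f = f" for f by (simp add: \<psi> comp_op_def o_def)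
    then show ?thesis
      using F.ritt_conditions_identity[OF assms(3) id] by blast
  next
    case 3
    note id = fock_ident[OF assms(1)]
    have "fock_norm p (\<lambda>z. z) \<noteq> 0"
      using F.norm_eq_0[OF id] by (metis zero_neq_one)
    moreover have eig: "comp_op \<psi> (\<lambda>z. z) = (\<lambda>z. a * z)"
      using 3 by (simp add: \<psi> comp_op_def o_def)
    ultimately have "\<not> ritt_resolvent_condition (fock_space p) (fock_norm p) (comp_op \<psi>)"
      "\<not> unconditional_ritt_condition (fock_space p) (fock_norm p) (comp_op \<psi>)"
      using F.ritt_resolvent_eigenvalue[of "comp_op \<psi>" "\<lambda>z. z" a]
        F.unconditional_ritt_eigenvalue[of "comp_op \<psi>" "\<lambda>z. z" a] id 3 by blast+
    moreover have "\<not> compact_op (fock_space p) (fock_norm p) (comp_op \<psi>)"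
      using rotation_not_compact[OF assms(1) 3(1)] 3 by (simp add: \<psi>)
    moreover have "comp_op \<psi> (\<lambda>z. z) \<noteq> (\<lambda>z. z)"
      unfolding eig using 3(2) by (metis mult.right_neutral)
    ultimately show ?thesis using id by blast
  qed
qed

end
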